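(* Let $\tilde{\mathcal H}^{\mathrm{UE}}$ and $\tilde{\mathcal H}^{\mathrm{BS}}$ denote the channel state information (CSI) available in the decoding at the receiver in the downlink and uplink, respectively; these are degraded as compared to $\mathcal H^{\mathrm{UE}}$ and $\mathcal H^{\mathrm{BS}}$, or equal. Let $\mathbf v^{\mathrm{DL}}=[v_1^{\mathrm{DL}}\dots v_N^{\mathrm{DL}}]^T$ (beamforming) and $\mathbf v^{\mathrm{UL}}=[v_1^{\mathrm{UL}}\dots v_N^{\mathrm{UL}}]^T$ (receive combining) be functions of the LMMSE channel estimate $\hat{\mathbf h}$ with unit norm. Then the downlink and uplink capacities are bounded as $${\tt C}^{\mathrm{DL}}\ge{\tt C}^{\mathrm{DL}}_{\mathrm{lower}}=\frac{T^{\mathrm{DL}}_{\mathrm{data}}}{T_{\mathrm{coher}}}\mathbb E\{\log_2(1+{\tt SINR}^{\mathrm{DL}}_{\mathrm{lower}}(\mathbf v^{\mathrm{DL}}))\},\qquad {\tt C}^{\mathrm{UL}}\ge{\tt C}^{\mathrm{UL}}_{\mathrm{lower}}=\frac{T^{\mathrm{UL}}_{\mathrm{data}}}{T_{\mathrm{coher}}}\mathbb E\{\log_2(1+{\tt SINR}^{\mathrm{UL}}_{\mathrm{lower}}(\mathbf v^{\mathrm{UL}}))\},$$ where the expectations are over $\tilde{\mathcal H}^{\mathrm{UE}}$ and $\tilde{\mathcal H}^{\mathrm{BS}}$, respectively, and $${\tt SINR}^{\mathrm{DL}}_{\mathrm{lower}}(\mathbf v^{\mathrm{DL}})=\frac{|\mathbb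 E\{\mathbf h^H\mathbf v^{\mathrm{DL}}|\tilde{\mathcal H}^{\mathrm{UE}}\}|^2}{D^{\mathrm{DL}}},\qquad {\tt SINR}^{\mathrm{UL}}_{\mathrm{lower}}(\mathbf v^{\mathrm{UL}})=\frac{|\mathbb E\{\mathbf h^H\mathbf v^{\mathrm{UL}}|\tilde{\mathcal H}^{\mathrm{BS}}\}|^2}{D^{\mathrm{UL}}},$$ $$D^{\mathrm{DL}}=(1+\kappa_r^{\mathrm{UE}})\mathbb E\{|\mathbf h^H\mathbf v^{\mathrm{DL}}|^2|\tilde{\mathcal H}^{\mathrm{UE}}\}-|\mathbb E\{\mathbf h^H\mathbf v^{\mathrm{DL}}|\tilde{\mathcal H}^{\mathrm{UE}}\}|^2+\kappa_t^{\mathrm{BS}}\sum_{i=1}^N\mathbb E\{|h_i|^2|v_i^{\mathrm{DL}}|^2|\tilde{\mathcal H}^{\mathrm{UE}}\}+\frac{\mathbb E\{I_{\mathcal H}^{\mathrm{UE}}|\tilde{\mathcal H}^{\mathrm{UE}}\}}{p^{\mathrm{BS}}}+\frac{\sigma_{\mathrm{UE}}^2}{p^{\mathrm{BS}}},$$ $$D^{\mathrm{UL}}=(1+\kappa_t^{\mathrm{UE}})\mathbb E\{|\mathbf h^H\mathbf v^{\mathrm{UL}}|^2|\tilde{\mathcal H}^{\mathrm{BS}}\}-|\mathbb E\{\mathbf h^H\mathbf v^{\mathrm{UL}}|\tilde{\mathcal H}^{\mathrm{BS}}\}|^2+\kappa_r^{\mathrm{BS}}\sum_{i=1}^N\mathbb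 E\{|h_i|^2|v_i^{\mathrm{UL}}|^2|\tilde{\mathcal H}^{\mathrm{BS}}\}+\frac{\mathbb E\{(\mathbf v^{\mathrm{UL}})^H(\mathbf Q_{\mathcal H}+\sigma_{\mathrm{BS}}^2\mathbf I)\mathbf v^{\mathrm{UL}}|\tilde{\mathcal H}^{\mathrm{BS}}\}}{p^{\mathrm{UE}}}.$$
   Context: An $N$-antenna base station (BS) and a single-antenna user (UE) share a reciprocal block-fading channel $\mathbf h=[h_1\dots h_N]^T\sim\mathcal{CN}(\mathbf 0,\mathbf R)$, constant in each coherence period of $T_{\mathrm{coher}}$ channel uses and independent between periods. Of each period, $T^{\mathrm{DL}}_{\mathrm{data}}$ (resp. $T^{\mathrm{UL}}_{\mathrm{data}}$) channel uses carry downlink (resp. uplink) data. $\mathcal H$ is the set of realizations of all useful and interfering channels ($\mathbf h\in\mathcal H$). Downlink: $y=\mathbf h^T(\mathbf s+\boldsymbol\eta_t^{\mathrm{BS}})+\eta_r^{\mathrm{UE}}+n$, with zero-mean data signal $\mathbf s$, $\mathbf W=\mathbb E\{\mathbf s\mathbf s^H\}$ (may depend on channel knowledge), $p^{\mathrm{BS}}=\mathrm{tr}(\mathbf W)$; given $\mathcal H$, $\boldsymbol\eta_t^{\mathrm{BS}}\sim\mathcal{CN}(\mathbf 0,\kappa_t^{\mathrm{BS}}\mathrm{diag}(W_{11},\dots,W_{NN}))$ and $\eta_r^{\mathrm{UE}}\sim\mathcal{CN}(0,\kappa_r^{\mathrm{UE}}\mathbf h^T\mathbf W\mathbf h^* )$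 are independent of each other and of $\mathbf s$; $n=n_{\mathrm{noise}}+n_{\mathrm{interf}}$ with independent noise $n_{\mathrm{noise}}\sim\mathcal{CN}(0,\sigma_{\mathrm{UE}}^2)$ and zero-mean interference independent of the data signal with conditional variance $I_{\mathcal H}^{\mathrm{UE}}$ given $\mathcal H$. Linear single-stream beamforming with $\mathbf v^{\mathrm{DL}}$ means $\mathbf s=(\mathbf v^{\mathrm{DL}})^*s$ with scalar data $s$ of power $p^{\mathrm{BS}}$. Uplink: $\mathbf z=\mathbf h(d+\eta_t^{\mathrm{UE}})+\boldsymbol\eta_r^{\mathrm{BS}}+\boldsymbol\nu$, with data signal $d$ of power $p^{\mathrm{UE}}$; given $\mathcal H$, $\eta_t^{\mathrm{UE}}\sim\mathcal{CN}(0,\kappa_t^{\mathrm{UE}}p^{\mathrm{UE}})$ and $\boldsymbol\eta_r^{\mathrm{BS}}\sim\mathcal{CN}(\mathbf 0,\kappa_r^{\mathrm{BS}}p^{\mathrm{UE}}\mathrm{diag}(|h_1|^2,\dots,|h_N|^2))$ are independent of each other and of $d$; $\boldsymbol\nu$ is the sum of independent noise $\mathcal{CN}(\mathbf 0,\sigma_{\mathrm{BS}}^2\mathbf I)$ and zero-mean interference independent of $d$ with conditional covariance $\mathbf Q_{\mathcal H}$ given $\mathcal H$ in the data phase. Distortion noises are temporally independent; all $\kappa\ge0$. Channel estimate: in the uplink pilot phase the BS observes $\mathbf z$ of the same form with $d$ a deterministic pilot, $|d|^2=p^{\mathrm{UE}}$, and interference covariance $\mathbf S$; $\hat{\mathbf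 h}=\mathbf A\mathbf z$ with $\mathbf A=d^*\mathbf R\bar{\mathbf Z}^{-1}$, $\bar{\mathbf Z}=p^{\mathrm{UE}}(1+\kappa_t^{\mathrm{UE}})\mathbf R+p^{\mathrm{UE}}\kappa_r^{\mathrm{BS}}\mathbf R_{\mathrm{diag}}+\mathbf S+\sigma_{\mathrm{BS}}^2\mathbf I$, $\mathbf R_{\mathrm{diag}}$ the diagonal part of $\mathbf R$ (the LMMSE estimate). The BS's knowledge $\mathcal H^{\mathrm{BS}}$ includes at least $\hat{\mathbf h}$. Capacities: with $\mathcal H^{\mathrm{BS}},\mathcal H^{\mathrm{UE}}$ the imperfect knowledge of $\mathcal H$ at the BS and UE, $${\tt C}^{\mathrm{DL}}=\frac{T^{\mathrm{DL}}_{\mathrm{data}}}{T_{\mathrm{coher}}}\mathbb E\Big\{\max_{f(\mathbf s|\mathcal H^{\mathrm{BS}}):\,\mathbb E\{\|\mathbf s\|_2^2\}\le p^{\mathrm{BS}}}\mathcal I(\mathbf s;y|\mathcal H,\mathcal H^{\mathrm{BS}},\mathcal H^{\mathrm{UE}})\Big\},$$ $${\tt C}^{\mathrm{UL}}=\frac{T^{\mathrm{UL}}_{\mathrm{data}}}{T_{\mathrm{coher}}}\mathbb E\Big\{\max_{f(d|\mathcal H^{\mathrm{UE}}):\,\mathbb E\{|d|^2\}\le p^{\mathrm{UE}}}\mathcal I(d;\mathbf z|\mathcal H,\mathcal H^{\mathrm{BS}},\mathcal H^{\mathrm{UE}})\Big\},$$ where $f(\cdot|\cdot)$ is the conditional distribution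 of the data signal, $\mathcal I$ is the conditional mutual information (in bits) for the given realizations, and the outer expectations are over the joint distribution of $\mathcal H,\mathcal H^{\mathrm{BS}},\mathcal H^{\mathrm{UE}}$. *)

theory Defs
  imports "HOL-Probability.Probability"
begin

subsection \<open>Complex vectors and Gaussian laws\<close>

text \<open>The number of antennas is \<^term>\<open>CARD('n)\<close>; \<open>herm x y\<close> is $x^H y$ and
  \<open>bilin x y\<close> is $x^T y$.\<close>

definition herm :: "complex ^ 'n \<Rightarrow> complex ^ 'n \<Rightarrow> complex" where
  "herm x y = (\<Sum>i\<in>UNIV. cnj (x $ i) * y $ i)"

definition bilin :: "complex ^ 'n \<Rightarrow> complex ^ 'n \<Rightarrow> complex" where
  "bilin x y = (\<Sum>i\<in>UNIV. x $ i * y $ i)"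

definition ctranspose :: "complex ^ 'n ^ 'm \<Rightarrow> complex ^ 'm ^ 'n" where
  "ctranspose A = (\<chi> i j. cnj (A $ j $ i))"

definition diag_part :: "complex ^ 'n ^ 'n \<Rightarrow> complex ^ 'n ^ 'n" where
  "diag_part A = (\<chi> i j. if i = j then A $ i $ i else 0)"

definition cvec :: "complex ^ 'n \<Rightarrow> complex ^ 'n" where
  "cvec x = (\<chi> i. cnj (x $ i))"

text \<open>\<open>cn v\<close> is the circularly symmetric law CN(0, v): real and imaginary parts are independent with
  variance v/2 each. It is written as a scaled standard law so that \<open>cn 0\<close> is the point mass at 0.\<close>

definition cn :: "real \<Rightarrow> complex measure" where
  "cn v = distr (density lborel std_normal_density \<Otimes>\<^sub>M density lborel std_normal_density) borel
            (\<lambda>(x, y). sqrt (v / 2) *\<^sub>R Complex x y)"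

text \<open>CN(0, diag(c)).\<close>

definition cn_diag :: "real ^ 'n \<Rightarrow> (complex ^ 'n) measure" where
  "cn_diag c = distr (\<Pi>\<^sub>M i\<in>UNIV. cn (c $ i)) borel (\<lambda>x. \<chi> i. x i)"

text \<open>\<open>mu\<close> is CN(0, R) for a possibly singular covariance matrix R: it is the law of $B w$ with
  $w$ distributed as CN(0, I) and $B B^H = R$. Such a $B$ exists exactly when R is Hermitian positive
  semidefinite, and the law does not depend on its choice.\<close>

definition is_cn :: "(complex ^ 'n) measure \<Rightarrow> complex ^ 'n ^ 'n \<Rightarrow> bool" where
  "is_cn mu R \<longleftrightarrow>
     (\<exists>B :: complex ^ 'n ^ 'n. B ** ctranspose B = R
        \<and> mu = distr (cn_diag (\<chi> i. 1)) borel (\<lambda>w. B *v w))"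

subsection \<open>Conditioning\<close>

definition gen_by :: "'w measure \<Rightarrow> ('w \<Rightarrow> 'c) \<Rightarrow> 'c measure \<Rightarrow> 'w measure" where
  "gen_by M C MC = vimage_algebra (space M) C MC"

definition complex_cond_exp :: "'w measure \<Rightarrow> 'w measure \<Rightarrow> ('w \<Rightarrow> complex) \<Rightarrow> 'w \<Rightarrow> complex" where
  "complex_cond_exp M F X = (\<lambda>w. Complex (real_cond_exp M F (\<lambda>w. Re (X w)) w)
                                         (real_cond_exp M F (\<lambda>w. Im (X w)) w))"

definition has_cond_law ::
  "'w measure \<Rightarrow> ('w \<Rightarrow> 'x) \<Rightarrow> 'x measure \<Rightarrow> ('w \<Rightarrow> 'c) \<Rightarrow> 'c measure \<Rightarrow> ('c \<Rightarrow> 'x measure) \<Rightarrow> bool" where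
  "has_cond_law M X MX C MC K \<longleftrightarrow>
     X \<in> M \<rightarrow>\<^sub>M MX \<and> C \<in> M \<rightarrow>\<^sub>M MC \<and> K \<in> MC \<rightarrow>\<^sub>M prob_algebra MX \<and>
     (\<forall>A\<in>sets MC. \<forall>B\<in>sets MX.
        emeasure M {w \<in> space M. C w \<in> A \<and> X w \<in> B}
        = (\<integral>\<^sup>+w. indicator A (C w) * emeasure (K (C w)) B \<partial>M))"

text \<open>The information F is degraded with respect to K, in an environment whose total information is
  G (with K contained in G): given K, F is conditionally independent of G. This covers every
  sub-sigma-algebra of K, in particular F = K, as well as randomly degraded versions of K.\<close>

definition degraded :: "'w measure \<Rightarrow> 'w measure \<Rightarrow> 'w measure \<Rightarrow> 'w measure \<Rightarrow> bool" where
  "degraded M G K F \<longleftrightarrow>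
     (\<forall>A\<in>sets F. AE w in M. real_cond_exp M G (indicator A) w = real_cond_exp M K (indicator A) w)"

lemma degraded_subalgebra:
  assumes "prob_space M" "subalgebra M G" "subalgebra G K" "subalgebra K F"
  shows "degraded M G K F"
  unfolding degraded_def
proof
  fix A assume A: "A \<in> sets F"
  have MK: "subalgebra M K" using assms(2,3) by (auto simp: subalgebra_def)
  have AK: "A \<in> sets K" and AG: "A \<in> sets G" and AM: "A \<in> sets M"
    using A assms by (auto simp: subalgebra_def)
  interpret prob_space M by fact
  interpret G: finite_measure_subalgebra M G by unfold_locales (fact assms(2))
  interpret K: finite_measure_subalgebra M K by unfold_locales (fact MK)
  have int: "integrable M (indicator A :: _ \<Rightarrow> real)"
    using AM by (intro integrable_real_indicator) (auto simp: less_top[symmetric])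
  have "AE w in M. real_cond_exp M G (indicator A) w = indicator A w"
    using int AG by (intro G.real_cond_exp_F_meas) auto
  moreover have "AE w in M. real_cond_exp M K (indicator A) w = indicator A w"
    using int AK by (intro K.real_cond_exp_F_meas) auto
  ultimately show "AE w in M. real_cond_exp M G (indicator A) w = real_cond_exp M K (indicator A) w"
    by eventually_elim simp
qed

subsection \<open>Pilot phase and LMMSE estimate\<close>

text \<open>Noise variances enter as \<open>sg\<^sup>2\<close>.
  Received uplink vector $z = h (d + \eta_t) + \eta_r + \nu$, used in the pilot phase with a
  deterministic $d$ and in the data phase with a random one.\<close>

definition ul_signal ::
  "complex ^ 'n \<Rightarrow> complex \<Rightarrow> complex \<Rightarrow> complex ^ 'n \<Rightarrow> complex ^ 'n \<Rightarrow> complex ^ 'n" where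
  "ul_signal h d eta_t eta_r nu = (d + eta_t) *s h + eta_r + nu"

text \<open>Given h: joint law of the transmit distortion at the UE, the receive distortion at the BS and
  the thermal noise at the BS, which are independent.\<close>

definition ul_noise_law ::
  "real \<Rightarrow> real \<Rightarrow> real \<Rightarrow> real \<Rightarrow> complex ^ 'n \<Rightarrow> (complex \<times> (complex ^ 'n) \<times> (complex ^ 'n)) measure" where
  "ul_noise_law kt kr sg p h =
     cn (kt * p) \<Otimes>\<^sub>M (cn_diag (\<chi> i. kr * p * (cmod (h $ i))\<^sup>2) \<Otimes>\<^sub>M cn_diag (\<chi> i. sg\<^sup>2))"

definition lmmse_Zbar ::
  "real \<Rightarrow> real \<Rightarrow> real \<Rightarrow> real \<Rightarrow> complex ^ 'n ^ 'n \<Rightarrow> complex ^ 'n ^ 'n \<Rightarrow> complex ^ 'n ^ 'n" where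
  "lmmse_Zbar kt kr sg p R S =
     (p * (1 + kt)) *\<^sub>R R + (p * kr) *\<^sub>R diag_part R + S + mat (complex_of_real (sg\<^sup>2))"

definition lmmse_estimate ::
  "real \<Rightarrow> real \<Rightarrow> real \<Rightarrow> real \<Rightarrow> complex ^ 'n ^ 'n \<Rightarrow> complex ^ 'n ^ 'n \<Rightarrow> complex
     \<Rightarrow> complex ^ 'n \<Rightarrow> complex ^ 'n" where
  "lmmse_estimate kt kr sg p R S d z =
     cnj d *s ((R ** matrix_inv (lmmse_Zbar kt kr sg p R S)) *v z)"

subsection \<open>Data phase: mutual information for given channel realizations\<close>

text \<open>Correlation matrix $W = E\{s s^H\}$ of a signal with law f.\<close>

definition corr_mat :: "(complex ^ 'n) measure \<Rightarrow> complex ^ 'n ^ 'n" where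
  "corr_mat f = (\<chi> i j. \<integral>s. s $ i * cnj (s $ j) \<partial>f)"

definition dl_input :: "real \<Rightarrow> (complex ^ 'n) measure \<Rightarrow> bool" where
  "dl_input p f \<longleftrightarrow> integrable f (\<lambda>s. (norm s)\<^sup>2) \<and> (\<integral>s. s \<partial>f) = 0 \<and> (\<integral>s. (norm s)\<^sup>2 \<partial>f) \<le> p"

definition ul_input :: "real \<Rightarrow> complex measure \<Rightarrow> bool" where
  "ul_input p f \<longleftrightarrow> integrable f (\<lambda>d. (cmod d)\<^sup>2) \<and> (\<integral>d. (cmod d)\<^sup>2 \<partial>f) \<le> p"

text \<open>Joint law, for a given channel h, of signal, distortions, thermal noise and interference; f is
  the law of the signal and J that of the interference. Since the distortions are independent of the
  signal and of the CSI given the channel, these are product measures.\<close>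

definition dl_law ::
  "real \<Rightarrow> real \<Rightarrow> real \<Rightarrow> complex ^ 'n \<Rightarrow> complex measure \<Rightarrow> (complex ^ 'n) measure
     \<Rightarrow> ((complex ^ 'n) \<times> (complex ^ 'n) \<times> complex \<times> complex \<times> complex) measure" where
  "dl_law kt kr sg h J f =
     f \<Otimes>\<^sub>M (cn_diag (\<chi> i. kt * Re (corr_mat f $ i $ i)) \<Otimes>\<^sub>M
        (cn (kr * Re (bilin h (corr_mat f *v cvec h))) \<Otimes>\<^sub>M (cn (sg\<^sup>2) \<Otimes>\<^sub>M J)))"

definition dl_mutual_info ::
  "real \<Rightarrow> real \<Rightarrow> real \<Rightarrow> complex ^ 'n \<Rightarrow> complex measure \<Rightarrow> (complex ^ 'n) measure \<Rightarrow> real" where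
  "dl_mutual_info kt kr sg h J f =
     prob_space.mutual_information (dl_law kt kr sg h J f) 2 borel borel
       (\<lambda>(s, eta_t, eta_r, n_noise, n_interf). s)
       (\<lambda>(s, eta_t, eta_r, n_noise, n_interf). bilin h (s + eta_t) + eta_r + (n_noise + n_interf))"

definition ul_mutual_info ::
  "real \<Rightarrow> real \<Rightarrow> real \<Rightarrow> real \<Rightarrow> complex ^ 'n \<Rightarrow> (complex ^ 'n) measure \<Rightarrow> complex measure \<Rightarrow> real" where
  "ul_mutual_info kt kr sg p h J f =
     prob_space.mutual_information (f \<Otimes>\<^sub>M (ul_noise_law kt kr sg p h \<Otimes>\<^sub>M J)) 2 borel borel
       (\<lambda>(d, (eta_t, eta_r, nu_noise), nu_interf). d)
       (\<lambda>(d, (eta_t, eta_r, nu_noise), nu_interf). ul_signal h d eta_t eta_r (nu_noise + nu_interf))"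

subsection \<open>Capacity\<close>

text \<open>\<open>info w f\<close> is the mutual information for the realizations at w with input law f. The input
  f(.|K) is a kernel that depends on the transmitter's knowledge K only, so one kernel has to serve
  all realizations of the remaining randomness. With positive thermal noise and a finite power
  constraint all the mutual informations are finite, so no information is lost by their being real.\<close>

definition input_kernels :: "'k measure \<Rightarrow> ('s::topological_space measure \<Rightarrow> bool) \<Rightarrow> ('k \<Rightarrow> 's measure) set" where
  "input_kernels MK adm = {f \<in> MK \<rightarrow>\<^sub>M prob_algebra borel. \<forall>k\<in>space MK. adm (f k)}"

definition ergodic_capacity ::
  "real \<Rightarrow> 'w measure \<Rightarrow> ('w \<Rightarrow> 'k) \<Rightarrow> 'k measure \<Rightarrow> ('s::topological_space measure \<Rightarrow> bool)
     \<Rightarrow> ('w \<Rightarrow> 's measure \<Rightarrow> real) \<Rightarrow> ennreal" where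
  "ergodic_capacity tau M K MK adm info =
     ennreal tau * (SUP f\<in>input_kernels MK adm. \<integral>\<^sup>+w. ennreal (info w (f (K w))) \<partial>M)"

text \<open>If the maximum is instead taken separately for each realization w, inside the expectation, the
  value can only increase; lower bounds on \<open>ergodic_capacity\<close> carry over.\<close>

lemma ergodic_capacity_le_pointwise:
  assumes K: "K \<in> M \<rightarrow>\<^sub>M MK"
  shows "ergodic_capacity tau M K MK adm info
    \<le> ennreal tau * (\<integral>\<^sup>+w. (SUP f\<in>{f \<in> space (prob_algebra borel). adm f}. ennreal (info w f)) \<partial>M)"
  unfolding ergodic_capacity_def
proof (intro mult_left_mono SUP_least nn_integral_mono)
  fix f w assume f: "f \<in> input_kernels MK adm" and w: "w \<in> space M"
  have k: "K w \<in> space MK" using K w by (rule measurable_space)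
  then have "f (K w) \<in> {f \<in> space (prob_algebra borel). adm f}"
    using f by (auto simp: input_kernels_def dest: measurable_space)
  then show "ennreal (info w (f (K w))) \<le> (SUP f\<in>{f \<in> space (prob_algebra borel). adm f}. ennreal (info w f))"
    by (rule SUP_upper)
qed simp

subsection \<open>Lower bounds\<close>

definition dl_sinr_lower ::
  "real \<Rightarrow> real \<Rightarrow> real \<Rightarrow> real \<Rightarrow> 'w measure \<Rightarrow> 'w measure \<Rightarrow> ('w \<Rightarrow> complex ^ 'n) \<Rightarrow> ('w \<Rightarrow> real)
     \<Rightarrow> ('w \<Rightarrow> complex ^ 'n) \<Rightarrow> 'w \<Rightarrow> real" where
  "dl_sinr_lower kt kr sg p M F h I v w =
     (cmod (complex_cond_exp M F (\<lambda>w. herm (h w) (v w)) w))\<^sup>2 /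
     ((1 + kr) * real_cond_exp M F (\<lambda>w. (cmod (herm (h w) (v w)))\<^sup>2) w
       - (cmod (complex_cond_exp M F (\<lambda>w. herm (h w) (v w)) w))\<^sup>2
       + kt * (\<Sum>i\<in>UNIV. real_cond_exp M F (\<lambda>w. (cmod (h w $ i))\<^sup>2 * (cmod (v w $ i))\<^sup>2) w)
       + real_cond_exp M F I w / p + sg\<^sup>2 / p)"

definition ul_sinr_lower ::
  "real \<Rightarrow> real \<Rightarrow> real \<Rightarrow> real \<Rightarrow> 'w measure \<Rightarrow> 'w measure \<Rightarrow> ('w \<Rightarrow> complex ^ 'n)
     \<Rightarrow> ('w \<Rightarrow> complex ^ 'n ^ 'n) \<Rightarrow> ('w \<Rightarrow> complex ^ 'n) \<Rightarrow> 'w \<Rightarrow> real" where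
  "ul_sinr_lower kt kr sg p M F h Q v w =
     (cmod (complex_cond_exp M F (\<lambda>w. herm (h w) (v w)) w))\<^sup>2 /
     ((1 + kt) * real_cond_exp M F (\<lambda>w. (cmod (herm (h w) (v w)))\<^sup>2) w
       - (cmod (complex_cond_exp M F (\<lambda>w. herm (h w) (v w)) w))\<^sup>2
       + kr * (\<Sum>i\<in>UNIV. real_cond_exp M F (\<lambda>w. (cmod (h w $ i))\<^sup>2 * (cmod (v w $ i))\<^sup>2) w)
       + real_cond_exp M F
           (\<lambda>w. Re (herm (v w) ((Q w + mat (complex_of_real (sg\<^sup>2))) *v v w))) w / p)"

definition ergodic_rate :: "real \<Rightarrow> 'w measure \<Rightarrow> ('w \<Rightarrow> real) \<Rightarrow> ennreal" where
  "ergodic_rate tau M sinr = ennreal tau * (\<integral>\<^sup>+w. ennreal (log 2 (1 + sinr w)) \<partial>M)"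

end

theory Submission
  imports Defs
begin

text \<open>Take Gaussian signalling with power p: \<open>s = x v\<^sup>*\<close> with \<open>x \<sim> CN(0, p)\<close> in the downlink,
  \<open>d \<sim> CN(0, p)\<close> in the uplink. For fixed realizations and for every linear estimate \<open>a y\<close> of \<open>x\<close>
  and every \<open>e > 0\<close>, comparing the true posterior of \<open>x\<close> with \<open>CN(a y, e)\<close> gives
  \<open>I(x; y) \<ge> log (p / e) + 1 - E |x - a y|\<^sup>2 / e\<close> (in nats). The constants a and e may depend on the
  realization in any way, in particular through the conditional moments of \<open>h\<^sup>H v\<close> given the degraded
  CSI. Choosing the coefficient and the error of the linear MMSE estimate built from these conditional
  moments, and averaging, turns the right-hand side into \<open>E log (1 + SINR)\<close>.

  All distortions and interferences are merely averaged over: a law to which independent Gaussian noise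
  of positive variance is added has, by Cameron-Martin, a density relative to the noise law, and this
  yields the densities on which the mutual information is computed.\<close>

subsection \<open>Gaussian laws\<close>

text \<open>Mutual information is a Bochner integral of a log-density, which is 0 by default when it
  does not converge, so explicit densities with integrable logarithms are required. Hence all
  densities are relative to the thermal noise law and controlled by exponentials of quadratics,
  which second moments suffice to integrate. The pair (a, e) carries the restriction to degraded
  CSI. The bound concerns the full mutual information at each realization; choosing a and e
  measurable in the degraded CSI lets them pass through its conditional expectation, so only the
  conditional means of \<open>herm h v\<close> and of the received power survive. For the MMSE
  choice, \<open>p / e\<close> is 1 + s with s the SINR, and the remaining terms average to -s + 2 s
  - s = 0. Positive thermal noise acts here a second time: it keeps the SINR denominator away from
  zero, which makes each of these terms integrable separately.\<close>

abbreviation std_normal :: "real measure" where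
  "std_normal \<equiv> density lborel std_normal_density"

lemma prob_space_std_normal: "prob_space std_normal"
  by (rule prob_space_normal_density) simp

lemma nn_integral_std_normal:
  "f \<in> borel_measurable borel \<Longrightarrow>
    (\<integral>\<^sup>+x. f x \<partial>std_normal) = (\<integral>\<^sup>+x. ennreal (std_normal_density x) * f x \<partial>lborel)"
  by (subst nn_integral_density) auto

text \<open>One-dimensional Cameron-Martin formula: translate in the Lebesgue integral and complete
  the square. Nonnegative extended integrands allow it to be iterated over coordinates without
  integrability conditions.\<close>

lemma nn_integral_std_normal_shift:
  fixes g :: "real \<Rightarrow> ennreal"
  assumes [measurable]: "g \<in> borel_measurable borel"
  shows "(\<integral>\<^sup>+x. g (a + x) \<partial>std_normal) = (\<integral>\<^sup>+x. ennreal (exp (a * x - a\<^sup>2 / 2)) * g x \<partial>std_normal)"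
proof -
  have *: "std_normal_density (x - a) = std_normal_density x * exp (a * x - a\<^sup>2 / 2)" for x
    unfolding std_normal_density_def
    by (simp add: exp_add[symmetric] power2_eq_square algebra_simps diff_divide_distrib add_divide_distrib)
  have "(\<integral>\<^sup>+x. g (a + x) \<partial>std_normal) = (\<integral>\<^sup>+x. ennreal (std_normal_density x) * g (a + x) \<partial>lborel)"
    by (rule nn_integral_std_normal) simp
  also have "\<dots> = (\<integral>\<^sup>+x. ennreal (std_normal_density (x - a)) * g x \<partial>lborel)"
    by (subst nn_integral_real_affine[where c = 1 and t = "- a"]) (auto simp: algebra_simps)
  also have "\<dots> = (\<integral>\<^sup>+x. ennreal (exp (a * x - a\<^sup>2 / 2)) * g x \<partial>std_normal)"
    by (subst nn_integral_std_normal) (auto simp: * ennreal_mult ac_simps)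
  finally show ?thesis .
qed

text \<open>The factor exp(x^2 / 2) cancels the standard normal density; what is left is the normal
  density with mean b / sqrt(p / 2) and standard deviation sqrt(e / p). This is one real coordinate
  of the complex normalization below.\<close>

lemma nn_integral_std_normal_tilt:
  assumes "0 < p" "0 < e"
  shows "(\<integral>\<^sup>+x. ennreal (sqrt (p / e) * exp (x\<^sup>2 / 2 - (sqrt (p / 2) * x - b)\<^sup>2 / e)) \<partial>std_normal) = 1"
proof -
  let ?s = "sqrt (p / 2)"
  have s: "?s\<^sup>2 = p / 2" "?s > 0" using assms by auto
  have *: "std_normal_density x * (sqrt (p / e) * exp (x\<^sup>2 / 2 - (?s * x - b)\<^sup>2 / e))
      = normal_density (b / ?s) (sqrt (e / p)) x" for x
  proof -
    have "(?s * x - b)\<^sup>2 = ?s\<^sup>2 * (x - b / ?s)\<^sup>2"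
      using s(2) by (subst power_mult_distrib[symmetric]) (simp add: algebra_simps)
    then have q: "(?s * x - b)\<^sup>2 / e = (x - b / ?s)\<^sup>2 / (2 * (e / p))"
      using assms by (simp add: s field_simps)
    have r: "sqrt (p / e) / sqrt (2 * pi) = 1 / sqrt (2 * pi * (e / p))"
      using assms by (simp add: real_sqrt_mult real_sqrt_divide)
    have "std_normal_density x * (sqrt (p / e) * exp (x\<^sup>2 / 2 - (?s * x - b)\<^sup>2 / e))
        = sqrt (p / e) / sqrt (2 * pi) * (exp (- x\<^sup>2 / 2) * exp (x\<^sup>2 / 2 - (?s * x - b)\<^sup>2 / e))"
      by (simp add: std_normal_density_def)
    also have "\<dots> = 1 / sqrt (2 * pi * (e / p)) * exp (- (x - b / ?s)\<^sup>2 / (2 * (e / p)))"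
      by (simp only: r exp_add[symmetric] q) (simp add: algebra_simps)
    finally show ?thesis
      using assms by (simp add: normal_density_def)
  qed
  have "(\<integral>\<^sup>+x. ennreal (sqrt (p / e) * exp (x\<^sup>2 / 2 - (?s * x - b)\<^sup>2 / e)) \<partial>std_normal)
     = (\<integral>\<^sup>+x. ennreal (normal_density (b / ?s) (sqrt (e / p)) x) \<partial>lborel)"
    using assms by (subst nn_integral_std_normal) (auto simp: ennreal_mult'[symmetric] * intro!: nn_integral_cong)
  also have "\<dots> = ennreal 1"
    using assms by (subst nn_integral_eq_integral) auto
  finally show ?thesis by simp
qed

lemma std_normal_moments:
  "integrable std_normal (\<lambda>x. x)" "(\<integral>x. x \<partial>std_normal) = 0"
  "integrable std_normal (\<lambda>x. x\<^sup>2)" "(\<integral>x. x\<^sup>2 \<partial>std_normal) = 1"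
proof -
  have 1: "has_bochner_integral lborel (\<lambda>x. std_normal_density x * x ^ 1) 0"
    using std_normal_moment_odd[of 0] by simp
  have 2: "has_bochner_integral lborel (\<lambda>x. std_normal_density x * x\<^sup>2) 1"
    using std_normal_moment_even[of 1] by (simp add: fact_numeral)
  show "integrable std_normal (\<lambda>x. x)" "(\<integral>x. x \<partial>std_normal) = 0"
    using 1 by (auto simp: integrable_density integral_density has_bochner_integral_iff)
  show "integrable std_normal (\<lambda>x. x\<^sup>2)" "(\<integral>x. x\<^sup>2 \<partial>std_normal) = 1"
    using 2 by (auto simp: integrable_density integral_density has_bochner_integral_iff)
qed

section \<open>Circularly symmetric complex Gaussians\<close>

abbreviation std_normal2 :: "(real \<times> real) measure" where
  "std_normal2 \<equiv> std_normal \<Otimes>\<^sub>M std_normal"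

lemma sets_cn [simp, measurable_cong]: "sets (cn v) = sets borel"
  by (simp add: cn_def)

lemma space_cn [simp]: "space (cn v) = UNIV"
  by (simp add: cn_def)

lemma Complex_measurable [measurable (raw)]:
  assumes [measurable]: "f \<in> borel_measurable M" "g \<in> borel_measurable M"
  shows "(\<lambda>x. Complex (f x) (g x)) \<in> borel_measurable M"
proof -
  have "(\<lambda>x. complex_of_real (f x) + \<i> * complex_of_real (g x)) \<in> borel_measurable M" by simp
  then show ?thesis by (simp add: Complex_eq)
qed

lemma borel_measurable_cnj [measurable (raw)]:
  "f \<in> borel_measurable M \<Longrightarrow> (\<lambda>x. cnj (f x)) \<in> borel_measurable M"
  by (rule measurable_compose[where f = f]) (auto intro!: borel_measurable_continuous_onI continuous_intros)

lemma prob_space_std_normal2: "prob_space std_normal2"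
  by (intro prob_space_pair prob_space_std_normal)

lemma prob_space_cn [simp]: "prob_space (cn v)"
  unfolding cn_def
  by (rule prob_space.prob_space_distr[OF prob_space_std_normal2]) (simp add: split_beta')

lemma nn_integral_cn:
  assumes [measurable]: "f \<in> borel_measurable borel"
  shows "(\<integral>\<^sup>+z. f z \<partial>cn v) =
    (\<integral>\<^sup>+x. (\<integral>\<^sup>+y. f (sqrt (v / 2) *\<^sub>R Complex x y) \<partial>std_normal) \<partial>std_normal)"
proof -
  interpret prob_space std_normal by (rule prob_space_std_normal)
  show ?thesis
    unfolding cn_def by (subst nn_integral_distr) (auto simp: split_beta' nn_integral_fst[symmetric])
qed

lemma nn_integral_cn_shift:
  fixes g :: "complex \<Rightarrow> ennreal"
  assumes [measurable]: "g \<in> borel_measurable borel" and v: "0 < v"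
  shows "(\<integral>\<^sup>+z. g (t + z) \<partial>cn v) = (\<integral>\<^sup>+z. ennreal (exp ((2 * (t \<bullet> z) - (norm t)\<^sup>2) / v)) * g z \<partial>cn v)"
proof -
  interpret prob_space std_normal by (rule prob_space_std_normal)
  define s where "s = sqrt (v / 2)"
  have s: "s > 0" "v = 2 * s\<^sup>2" using v by (auto simp: s_def)
  \<comment> \<open>Coordinates of t in units of the standard deviation per real dimension; the
    exponent then separates into two one-dimensional ones.\<close>
  define a b where "a = Re t / s" and "b = Im t / s"
  have ab: "t = s *\<^sub>R Complex a b" using s by (simp add: a_def b_def complex_eq_iff)
  have e: "(2 * (t \<bullet> (s *\<^sub>R Complex x y)) - (norm t)\<^sup>2) / v = (a * x - a\<^sup>2 / 2) + (b * y - b\<^sup>2 / 2)" for x y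
    unfolding ab s(2) using s(1)
    by (simp add: inner_complex_def cmod_power2 power_mult_distrib field_simps del: norm_scaleR)
      (simp add: power2_eq_square algebra_simps)
  have "(\<integral>\<^sup>+z. g (t + z) \<partial>cn v) =
    (\<integral>\<^sup>+x. (\<integral>\<^sup>+y. g (s *\<^sub>R Complex (a + x) (b + y)) \<partial>std_normal) \<partial>std_normal)"
    by (subst nn_integral_cn) (simp_all add: s_def[symmetric] ab complex_add scaleR_add_right[symmetric])
  also have "\<dots> = (\<integral>\<^sup>+x. (\<integral>\<^sup>+y. ennreal (exp (b * y - b\<^sup>2 / 2)) * g (s *\<^sub>R Complex (a + x) y) \<partial>std_normal) \<partial>std_normal)"
    by (intro nn_integral_cong nn_integral_std_normal_shift) simp
  also have "\<dots> = (\<integral>\<^sup>+x. ennreal (exp (a * x - a\<^sup>2 / 2)) *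
      (\<integral>\<^sup>+y. ennreal (exp (b * y - b\<^sup>2 / 2)) * g (s *\<^sub>R Complex x y) \<partial>std_normal) \<partial>std_normal)"
    by (subst nn_integral_std_normal_shift[symmetric]) auto
  also have "\<dots> = (\<integral>\<^sup>+x. (\<integral>\<^sup>+y. ennreal (exp (a * x - a\<^sup>2 / 2)) *
      (ennreal (exp (b * y - b\<^sup>2 / 2)) * g (s *\<^sub>R Complex x y)) \<partial>std_normal) \<partial>std_normal)"
    by (intro nn_integral_cong nn_integral_cmult[symmetric]) simp
  also have "\<dots> = (\<integral>\<^sup>+z. ennreal (exp ((2 * (t \<bullet> z) - (norm t)\<^sup>2) / v)) * g z \<partial>cn v)"
    by (subst nn_integral_cn) (auto simp: s_def[symmetric] e exp_add ennreal_mult mult.assoc simp del: inner_scaleR_right)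
  finally show ?thesis .
qed

text \<open>The exponent is the logarithm of the density of CN(b, e) relative to CN(0, p), so the
  integral is the total mass of CN(b, e). This is what makes a Gaussian guess of the posterior
  admissible in the variational bound.\<close>

lemma nn_integral_cn_tilt:
  assumes p: "0 < p" and e: "0 < e"
  shows "(\<integral>\<^sup>+z. ennreal (exp (ln (p / e) + (norm z)\<^sup>2 / p - (norm (z - b))\<^sup>2 / e)) \<partial>cn p) = 1"
proof -
  define s where "s = sqrt (p / 2)"
  have s: "s > 0" "p = 2 * s\<^sup>2" using p by (auto simp: s_def)
  define r where "r = sqrt (p / e)"
  define G where "G b x = r * exp (x\<^sup>2 / 2 - (s * x - b)\<^sup>2 / e)" for b x
  have [measurable]: "G c \<in> borel_measurable borel" for c unfolding G_def by measurable
  have G: "G c x \<ge> 0" for c x using p e by (simp add: G_def r_def)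
  have *: "exp (ln (p / e) + (norm (s *\<^sub>R Complex x y))\<^sup>2 / p - (norm (s *\<^sub>R Complex x y - b))\<^sup>2 / e)
     = G (Re b) x * G (Im b) y" for x y
  proof -
    have "(norm (s *\<^sub>R Complex x y))\<^sup>2 / p = x\<^sup>2 / 2 + y\<^sup>2 / 2"
      using s by (simp add: cmod_power2 field_simps power_mult_distrib del: norm_scaleR)
    moreover have "(norm (s *\<^sub>R Complex x y - b))\<^sup>2 / e = (s * x - Re b)\<^sup>2 / e + (s * y - Im b)\<^sup>2 / e"
      by (simp add: cmod_power2 add_divide_distrib)
    moreover have "exp (ln (p / e)) = r * r" using p e by (simp add: r_def)
    ultimately show ?thesis by (simp only: G_def exp_add exp_diff) (simp add: field_simps)
  qed
  have 1: "(\<integral>\<^sup>+x. ennreal (G c x) \<partial>std_normal) = 1" for c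
    unfolding G_def s_def r_def using p e by (rule nn_integral_std_normal_tilt)
  have "(\<integral>\<^sup>+z. ennreal (exp (ln (p / e) + (norm z)\<^sup>2 / p - (norm (z - b))\<^sup>2 / e)) \<partial>cn p)
    = (\<integral>\<^sup>+x. (\<integral>\<^sup>+y. ennreal (G (Re b) x) * ennreal (G (Im b) y) \<partial>std_normal) \<partial>std_normal)"
    by (subst nn_integral_cn) (auto simp: s_def[symmetric] * ennreal_mult G simp del: norm_scaleR)
  also have "\<dots> = 1" by (simp add: nn_integral_cmult 1)
  finally show ?thesis .
qed

section \<open>Zero-mean square-integrable variables and independent sums\<close>

text \<open>Packaged so that estimation errors are computed by scaling and independent addition
  alone. Square integrability gives the zero mean its meaning, since the integral of a nonintegrable
  function is 0 by default.\<close>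

definition centered :: "'a measure \<Rightarrow> ('a \<Rightarrow> complex) \<Rightarrow> real \<Rightarrow> bool" where
  "centered M f v \<longleftrightarrow> prob_space M \<and> f \<in> borel_measurable M \<and> integrable M (\<lambda>x. (cmod (f x))\<^sup>2)
     \<and> (\<integral>x. f x \<partial>M) = 0 \<and> (\<integral>x. (cmod (f x))\<^sup>2 \<partial>M) = v"

lemma (in prob_space) integrable_of_square_norm:
  fixes f :: "'a \<Rightarrow> 'b::{banach, second_countable_topology}"
  assumes "f \<in> borel_measurable M" "integrable M (\<lambda>x. (norm (f x))\<^sup>2)"
  shows "integrable M f"
proof (rule Bochner_Integration.integrable_bound)
  show "integrable M (\<lambda>x. 1 + (norm (f x))\<^sup>2)" using assms by simp
  have "t \<le> 1 + t\<^sup>2" for t :: real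
  proof -
    have "0 \<le> (t - 1)\<^sup>2" by simp
    then have "2 * t \<le> t\<^sup>2 + 1" by (simp add: power2_diff)
    with zero_le_power2[of t] show ?thesis by linarith
  qed
  then show "AE x in M. norm (f x) \<le> norm (1 + (norm (f x))\<^sup>2)"
    by (simp)
qed (use assms in auto)

lemma centeredD:
  assumes "centered M f v"
  shows "prob_space M" "f \<in> borel_measurable M" "integrable M (\<lambda>x. (cmod (f x))\<^sup>2)"
    "(\<integral>x. f x \<partial>M) = 0" "(\<integral>x. (cmod (f x))\<^sup>2 \<partial>M) = v" "integrable M f"
  using assms by (auto simp: centered_def intro: prob_space.integrable_of_square_norm)

lemma centered_mult:
  assumes "centered M f v"
  shows "centered M (\<lambda>x. c * f x) ((cmod c)\<^sup>2 * v)"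
  using centeredD[OF assms] by (auto simp: centered_def norm_mult power_mult_distrib)

lemma centered_distr:
  assumes "prob_space M" "g \<in> M \<rightarrow>\<^sub>M N" "f \<in> borel_measurable N"
  shows "centered (distr M N g) f v \<longleftrightarrow> centered M (\<lambda>x. f (g x)) v"
  using assms by (auto simp: centered_def integrable_distr_eq integral_distr intro: prob_space.prob_space_distr)

lemma (in prob_space) distr_pair_snd: "distr (M \<Otimes>\<^sub>M N) N snd = N"
  if "sigma_finite_measure N"
proof (intro measure_eqI)
  interpret N: sigma_finite_measure N by fact
  fix A assume A: "A \<in> sets (distr (M \<Otimes>\<^sub>M N) N snd)"
  then have "emeasure (distr (M \<Otimes>\<^sub>M N) N snd) A = emeasure (M \<Otimes>\<^sub>M N) (space M \<times> A)"
    by (auto simp add: emeasure_distr space_pair_measure dest: sets.sets_into_space intro!: arg_cong2[where f=emeasure])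
  with A show "emeasure (distr (M \<Otimes>\<^sub>M N) N snd) A = emeasure N A"
    by (simp add: N.emeasure_pair_measure_Times emeasure_space_1)
qed simp

lemma integral_pair_fst:
  fixes k :: "'a \<Rightarrow> 'c::{banach, second_countable_topology}"
  assumes "prob_space N" and k: "integrable M k"
  shows "integrable (M \<Otimes>\<^sub>M N) (\<lambda>x. k (fst x))" "(\<integral>x. k (fst x) \<partial>(M \<Otimes>\<^sub>M N)) = integral\<^sup>L M k"
proof -
  interpret N: prob_space N by fact
  have [measurable]: "k \<in> borel_measurable M" using k by simp
  show "integrable (M \<Otimes>\<^sub>M N) (\<lambda>x. k (fst x))"
    using k by (subst integrable_distr_eq[symmetric, where N = M]) (auto simp: N.distr_pair_fst)
  have "integral\<^sup>L M k = integral\<^sup>L (distr (M \<Otimes>\<^sub>M N) M fst) k"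
    by (simp add: N.distr_pair_fst)
  also have "\<dots> = (\<integral>x. k (fst x) \<partial>(M \<Otimes>\<^sub>M N))" by (rule integral_distr) auto
  finally show "(\<integral>x. k (fst x) \<partial>(M \<Otimes>\<^sub>M N)) = integral\<^sup>L M k" ..
qed

lemma integral_pair_snd:
  fixes k :: "'a \<Rightarrow> 'c::{banach, second_countable_topology}"
  assumes "prob_space M" "prob_space N" and k: "integrable N k"
  shows "integrable (M \<Otimes>\<^sub>M N) (\<lambda>x. k (snd x))" "(\<integral>x. k (snd x) \<partial>(M \<Otimes>\<^sub>M N)) = integral\<^sup>L N k"
proof -
  interpret M: prob_space M by fact
  interpret N: prob_space N by fact
  note d = M.distr_pair_snd[OF N.sigma_finite_measure_axioms]
  have [measurable]: "k \<in> borel_measurable N" using k by simp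
  show "integrable (M \<Otimes>\<^sub>M N) (\<lambda>x. k (snd x))"
    using k by (subst integrable_distr_eq[symmetric, where N = N]) (auto simp: d)
  have "integral\<^sup>L N k = integral\<^sup>L (distr (M \<Otimes>\<^sub>M N) N snd) k"
    by (simp add: d)
  also have "\<dots> = (\<integral>x. k (snd x) \<partial>(M \<Otimes>\<^sub>M N))" by (rule integral_distr) auto
  finally show "(\<integral>x. k (snd x) \<partial>(M \<Otimes>\<^sub>M N)) = integral\<^sup>L N k" ..
qed

text \<open>Variances of independent terms add because the cross term integrates to zero by Fubini,
  the mean of g being zero.\<close>

lemma centered_pair:
  assumes f: "centered M f v" and g: "centered N g w"
  shows "centered (M \<Otimes>\<^sub>M N) (\<lambda>(x, y). f x + g y) (v + w)"
proof -
  note [simp] = centeredD[OF f] centeredD[OF g]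
  note [measurable] = centeredD(2)[OF f] centeredD(2)[OF g]
  interpret M: prob_space M by simp
  interpret N: prob_space N by simp
  interpret P: pair_prob_space M N ..
  note fst = integral_pair_fst[OF N.prob_space_axioms]
    and snd = integral_pair_snd[OF M.prob_space_axioms N.prob_space_axioms]
  have sq: "(cmod (a + b))\<^sup>2 = (cmod a)\<^sup>2 + (cmod b)\<^sup>2 + 2 * Re (a * cnj b)" for a b
    by (simp only: cmod_power2) (simp add: algebra_simps power2_eq_square)
  have cross: "integrable (M \<Otimes>\<^sub>M N) (\<lambda>x. f (fst x) * cnj (g (snd x)))"
    by (rule P.Fubini_integrable) (simp_all add: norm_mult)
  have "(\<integral>x. f (fst x) * cnj (g (snd x)) \<partial>(M \<Otimes>\<^sub>M N)) = 0"
    using P.integral_fst'[OF cross] by simp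
  then have cross0: "(\<integral>x. Re (f (fst x) * cnj (g (snd x))) \<partial>(M \<Otimes>\<^sub>M N)) = 0"
    using integral_Re[OF cross] by simp
  have crossi: "integrable (M \<Otimes>\<^sub>M N) (\<lambda>x. Re (f (fst x) * cnj (g (snd x))))"
    by (rule integrable_Re[OF cross])
  note i = fst[OF centeredD(3)[OF f]] snd[OF centeredD(3)[OF g]]
    fst[OF centeredD(6)[OF f]] snd[OF centeredD(6)[OF g]]
  define c where "c x = Re (f (fst x) * cnj (g (snd x)))" for x
  show ?thesis
    unfolding centered_def split_beta' sq c_def[symmetric]
    using i cross0 crossi P.prob_space_axioms by (simp add: c_def[symmetric] del: times_complex.sel)
qed

text \<open>Nonnegativity of v matters: \<open>sqrt\<close> is an odd function on the reals, so for
  negative v the law \<open>cn v\<close> has variance -v.\<close>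

lemma centered_cn:
  assumes "0 \<le> v" shows "centered (cn v) (\<lambda>z. z) v"
proof -
  define s where "s = sqrt (v / 2)"
  have v: "v = s\<^sup>2 + s\<^sup>2" using assms by (simp add: s_def)
  have "centered std_normal (\<lambda>x. complex_of_real x) 1"
    using std_normal_moments prob_space_std_normal by (auto simp: centered_def)
  note c = centered_mult[OF this]
  have "centered std_normal2 (\<lambda>(x, y). of_real s * of_real x + \<i> * of_real s * of_real y) v"
    using centered_pair[OF c[of "of_real s"] c[of "\<i> * of_real s"]] by (simp add: v norm_mult)
  also have "(\<lambda>(x, y). of_real s * of_real x + \<i> * of_real s * of_real y) = (\<lambda>(x, y). s *\<^sub>R Complex x y)"
    by (auto simp: complex_eq_iff)
  finally show ?thesis
    unfolding cn_def s_def
    by (subst centered_distr[OF prob_space_std_normal2]) (auto simp: split_beta')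
qed

section \<open>Complex Gaussian vectors with independent components\<close>

lemma borel_measurable_vec_iff:
  fixes f :: "'a \<Rightarrow> complex ^ 'n"
  shows "f \<in> borel_measurable M \<longleftrightarrow> (\<forall>i. (\<lambda>x. f x $ i) \<in> borel_measurable M)"
proof
  assume f: "f \<in> borel_measurable M"
  have "(\<lambda>v :: complex ^ 'n. v $ i) \<in> borel_measurable borel" for i
    by (intro borel_measurable_continuous_onI continuous_intros)
  from measurable_compose[OF f this] show "\<forall>i. (\<lambda>x. f x $ i) \<in> borel_measurable M" by auto
next
  assume [rule_format, measurable]: "\<forall>i. (\<lambda>x. f x $ i) \<in> borel_measurable M"
  show "f \<in> borel_measurable M"
    by (subst borel_measurable_euclidean_space) (auto simp: Basis_vec_def inner_axis)
qed

lemma borel_measurable_vec_nth [measurable (raw)]: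
  "f \<in> borel_measurable M \<Longrightarrow> (\<lambda>x. (f x :: complex ^ 'n) $ i) \<in> borel_measurable M"
  by (simp add: borel_measurable_vec_iff)

lemma borel_measurable_vec_lambda [measurable (raw)]:
  "(\<And>i. (\<lambda>x. f x i) \<in> borel_measurable M) \<Longrightarrow> (\<lambda>x. (\<chi> i. f x i) :: complex ^ 'n) \<in> borel_measurable M"
  by (simp add: borel_measurable_vec_iff)

lemma norm_vec_sq: "(norm (x :: complex ^ 'n))\<^sup>2 = (\<Sum>i\<in>UNIV. (cmod (x $ i))\<^sup>2)"
  by (simp add: norm_vec_def L2_set_def sum_nonneg)

lemma sets_cn_diag [simp, measurable_cong]: "sets (cn_diag c) = sets borel"
  by (simp add: cn_diag_def)

abbreviation cn_prod :: "real ^ 'n \<Rightarrow> ('n \<Rightarrow> complex) measure" where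
  "cn_prod c \<equiv> \<Pi>\<^sub>M i\<in>UNIV. cn (c $ i)"

lemma prob_space_cn_prod: "prob_space (cn_prod c)"
  by (intro prob_space_PiM) simp

lemma measurable_cn_prod_component [measurable]: "(\<lambda>x. x i) \<in> borel_measurable (cn_prod c)"
proof -
  have "(\<lambda>x. x i) \<in> cn_prod c \<rightarrow>\<^sub>M cn (c $ i)" by (rule measurable_component_singleton) simp
  then show ?thesis by (simp add: measurable_cong_sets[OF refl sets_cn])
qed

lemma measurable_cn_prod_vec [measurable]: "(\<lambda>x. \<chi> i. x i) \<in> borel_measurable (cn_prod c)"
  by (simp add: borel_measurable_vec_iff)

lemma prob_space_cn_diag [simp]: "prob_space (cn_diag c)"
  unfolding cn_diag_def by (rule prob_space.prob_space_distr[OF prob_space_cn_prod]) simp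

text \<open>A product measure is determined by its values on boxes, where the scalar shift formula
  applies factor by factor. Both the translated law and the exponentially weighted law are thereby
  identified with the product of the translated components.\<close>

lemma nn_integral_cn_diag_shift:
  fixes g :: "complex ^ 'n \<Rightarrow> ennreal" and t :: "complex ^ 'n"
  assumes [measurable]: "g \<in> borel_measurable borel" and v: "0 < v"
  shows "(\<integral>\<^sup>+z. g (t + z) \<partial>cn_diag (\<chi> i. v)) =
    (\<integral>\<^sup>+z. ennreal (exp ((2 * (t \<bullet> z) - (norm t)\<^sup>2) / v)) * g z \<partial>cn_diag (\<chi> i. v))"
proof -
  let ?P = "\<Pi>\<^sub>M i\<in>(UNIV :: 'n set). cn v" and ?B = "\<Pi>\<^sub>M i\<in>(UNIV :: 'n set). (borel :: complex measure)"
  let ?D = "\<lambda>i :: 'n. distr (cn v) borel (\<lambda>z. t $ i + z)"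
  define r where "r i z = exp ((2 * (t $ i \<bullet> z) - (norm (t $ i))\<^sup>2) / v)" for i z
  have [measurable]: "r i \<in> borel_measurable borel" for i unfolding r_def by measurable
  have P: "?P = cn_prod (\<chi> i. v)" by simp
  have [measurable]: "(\<lambda>x. x i) \<in> borel_measurable ?P" for i unfolding P by measurable
  have [measurable]: "(\<lambda>x. \<chi> i. x i) \<in> borel_measurable ?P" unfolding P by measurable
  have sets_P: "sets ?P = sets ?B" by (intro sets_PiM_cong) auto
  have shiftP: "(\<lambda>x i. t $ i + x i) \<in> ?P \<rightarrow>\<^sub>M ?B"
    by (rule measurable_PiM_single') auto
  interpret cn: product_prob_space "\<lambda>_ :: 'n. cn v" UNIV
    by (intro product_prob_spaceI) simp
  have shift[measurable]: "(\<lambda>z. t $ i + z) \<in> borel_measurable (cn v)" for i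
    by (intro borel_measurable_add borel_measurable_const) (simp add: measurable_cong_sets[OF sets_cn refl])
  interpret D: product_prob_space ?D UNIV
    by (intro product_prob_spaceI prob_space.prob_space_distr prob_space_cn shift)
  have prod_r: "(\<Prod>i\<in>UNIV. r i (x i)) = exp ((2 * (t \<bullet> (\<chi> i. x i)) - (norm t)\<^sup>2) / v)" for x
    unfolding r_def exp_sum[symmetric, OF finite]
    by (simp add: inner_vec_def norm_vec_sq sum_divide_distrib[symmetric] sum_subtractf sum_distrib_left)
  have box: "(\<lambda>x i. t $ i + x i) -` Pi\<^sub>E UNIV A \<inter> space ?P = (\<Pi>\<^sub>E i\<in>UNIV. (\<lambda>z. t $ i + z) -` A i)" for A
    by (auto simp: space_PiM PiE_iff)
  have *: "A \<in> sets borel \<Longrightarrow> emeasure (cn v) ((\<lambda>z. t $ i + z) -` A) = (\<integral>\<^sup>+z. ennreal (r i z) * indicator A z \<partial>cn v)" for A i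
  proof -
    assume [measurable]: "A \<in> sets borel"
    have "emeasure (cn v) ((\<lambda>z. t $ i + z) -` A) = (\<integral>\<^sup>+z. indicator A (t $ i + z) \<partial>cn v)"
      by (subst nn_integral_indicator[symmetric]) (auto simp: indicator_def measurable_sets_borel
        intro!: nn_integral_cong measurable_sets_borel[of _ borel])
    also have "\<dots> = (\<integral>\<^sup>+z. ennreal (r i z) * indicator A z \<partial>cn v)"
      unfolding r_def by (rule nn_integral_cn_shift) (auto simp: v)
    finally show ?thesis .
  qed
  have 1: "distr ?P ?B (\<lambda>x i. t $ i + x i) = Pi\<^sub>M UNIV ?D"
  proof (rule D.PiM_eqI)
    show "sets (distr ?P ?B (\<lambda>x i. t $ i + x i)) = sets (Pi\<^sub>M UNIV ?D)"
      by (simp cong: sets_PiM_cong)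
    fix A assume A: "\<And>i. i \<in> UNIV \<Longrightarrow> A i \<in> sets (?D i)"
    then have "emeasure (distr ?P ?B (\<lambda>x i. t $ i + x i)) (Pi\<^sub>E UNIV A)
       = emeasure ?P (\<Pi>\<^sub>E i\<in>UNIV. (\<lambda>z. t $ i + z) -` A i)"
      by (subst emeasure_distr[OF shiftP]) (auto simp: box intro!: sets_PiM_I_finite)
    also have "\<dots> = (\<Prod>i\<in>UNIV. emeasure (cn v) ((\<lambda>z. t $ i + z) -` A i))"
      using A by (subst cn.emeasure_PiM) (auto intro!: measurable_sets_borel[of _ borel])
    also have "\<dots> = (\<Prod>i\<in>UNIV. emeasure (?D i) (A i))"
      using A by (intro prod.cong) (auto simp: emeasure_distr)
    finally show "emeasure (distr ?P ?B (\<lambda>x i. t $ i + x i)) (Pi\<^sub>E UNIV A) = (\<Prod>i\<in>UNIV. emeasure (?D i) (A i))" .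
  qed simp
  have 2: "density ?P (\<lambda>x. ennreal (\<Prod>i\<in>UNIV. r i (x i))) = Pi\<^sub>M UNIV ?D"
  proof (rule D.PiM_eqI)
    show "sets (density ?P (\<lambda>x. ennreal (\<Prod>i\<in>UNIV. r i (x i)))) = sets (Pi\<^sub>M UNIV ?D)"
      by (simp cong: sets_PiM_cong)
    fix A assume "\<And>i. i \<in> UNIV \<Longrightarrow> A i \<in> sets (?D i)"
    then have A[measurable]: "A i \<in> sets borel" for i by simp
    have "Pi\<^sub>E UNIV A \<in> sets ?P" by (subst sets_P) (auto intro!: sets_PiM_I_finite)
    then have "emeasure (density ?P (\<lambda>x. ennreal (\<Prod>i\<in>UNIV. r i (x i)))) (Pi\<^sub>E UNIV A)
      = (\<integral>\<^sup>+x. ennreal (\<Prod>i\<in>UNIV. r i (x i)) * indicator (Pi\<^sub>E UNIV A) x \<partial>?P)"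
      by (subst emeasure_density) auto
    also have "\<dots> = (\<integral>\<^sup>+x. (\<Prod>i\<in>UNIV. ennreal (r i (x i)) * indicator (A i) (x i)) \<partial>?P)"
      by (intro nn_integral_cong) (auto simp: r_def prod_ennreal[symmetric] prod.distrib indicator_def PiE_iff)
    also have "\<dots> = (\<Prod>i\<in>UNIV. \<integral>\<^sup>+z. ennreal (r i z) * indicator (A i) z \<partial>cn v)"
      by (rule cn.product_nn_integral_prod) (simp_all add: measurable_cong_sets[OF sets_cn refl])
    also have "\<dots> = (\<Prod>i\<in>UNIV. emeasure (?D i) (A i))"
      using A by (intro prod.cong) (auto simp: emeasure_distr *)
    finally show "emeasure (density ?P (\<lambda>x. ennreal (\<Prod>i\<in>UNIV. r i (x i)))) (Pi\<^sub>E UNIV A)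
      = (\<Prod>i\<in>UNIV. emeasure (?D i) (A i))" .
  qed simp
  have [measurable]: "(\<lambda>x. \<chi> i. x i) \<in> borel_measurable ?B"
    by (simp add: borel_measurable_vec_iff)
  have vec: "(\<chi> i. t $ i + x i) = t + (\<chi> i. x i)" for x by (simp add: vec_eq_iff)
  have "(\<integral>\<^sup>+z. g (t + z) \<partial>cn_diag (\<chi> i. v)) = (\<integral>\<^sup>+x. g (\<chi> i. x i) \<partial>distr ?P ?B (\<lambda>x i. t $ i + x i))"
    by (simp add: cn_diag_def nn_integral_distr nn_integral_distr[OF shiftP] vec)
  also have "\<dots> = (\<integral>\<^sup>+x. g (\<chi> i. x i) \<partial>density ?P (\<lambda>x. ennreal (\<Prod>i\<in>UNIV. r i (x i))))"
    by (simp add: 1 2)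
  also have "\<dots> = (\<integral>\<^sup>+z. ennreal (exp ((2 * (t \<bullet> z) - (norm t)\<^sup>2) / v)) * g z \<partial>cn_diag (\<chi> i. v))"
    by (simp add: cn_diag_def nn_integral_distr nn_integral_density prod_r[symmetric] del: prod_r)
  finally show ?thesis .
qed

lemma cn_diag_component: "distr (cn_diag c) borel (\<lambda>z. z $ i) = cn (c $ i)"
proof -
  have "distr (cn_diag c) borel (\<lambda>z. z $ i) = distr (cn_prod c) borel (\<lambda>x. x i)"
    unfolding cn_diag_def by (subst distr_distr) (auto simp: comp_def)
  also have "\<dots> = distr (cn_prod c) (cn (c $ i)) (\<lambda>x. x i)" by (intro distr_cong) auto
  also have "\<dots> = cn (c $ i)" by (rule distr_PiM_component[of UNIV "\<lambda>i. cn (c $ i)"]) auto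
  finally show ?thesis .
qed

lemma centered_cn_diag_component:
  assumes "0 \<le> c $ i" shows "centered (cn_diag c) (\<lambda>z. z $ i) (c $ i)"
  using centered_cn[OF assms] unfolding cn_diag_component[symmetric, of c i]
  by (subst (asm) centered_distr) (auto simp: borel_measurable_vec_iff)

lemma integrable_cn_diag_sq:
  assumes "\<And>i. 0 \<le> c $ i"
  shows "integrable (cn_diag c) (\<lambda>z. (norm z)\<^sup>2)"
  unfolding norm_vec_sq using centeredD(3)[OF centered_cn_diag_component[OF assms]] by simp

lemma vec_integral_nth:
  fixes f :: "'a \<Rightarrow> complex ^ 'n"
  assumes "integrable M f" shows "(\<integral>x. f x \<partial>M) $ i = (\<integral>x. f x $ i \<partial>M)"
  using integral_bounded_linear[OF bounded_linear_vec_nth assms] by simp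

lemma integral_cn_diag_cross:
  assumes c: "\<And>i. 0 \<le> c $ i" and ij: "i \<noteq> j"
  shows "(\<integral>z. z $ i * cnj (z $ j) \<partial>cn_diag c) = 0"
proof -
  interpret cn: product_prob_space "\<lambda>i. cn (c $ i)" UNIV
    by (intro product_prob_spaceI) simp
  \<comment> \<open>Padding with the constant 1 writes the product of two coordinates as a product
    over all coordinates, the form that the product integral formula requires.\<close>
  define f where "f k z = (if k = i then z else if k = j then cnj z else 1)" for k z
  note cD = centeredD[OF centered_cn[OF c]]
  have int: "integrable (cn (c $ k)) (f k)" for k
    unfolding f_def using cD(6)[of k] prob_space.finite_measure[OF prob_space_cn]
    by (cases "k = i"; cases "k = j") (auto intro: finite_measure.integrable_const)
  have "(\<Prod>k\<in>UNIV. f k (z k)) = z i * cnj (z j)" for z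
  proof -
    have "(\<Prod>k\<in>UNIV. f k (z k)) = (\<Prod>k\<in>{i, j}. f k (z k))"
      by (rule prod.mono_neutral_right) (auto simp: f_def)
    then show ?thesis using ij by (simp add: f_def)
  qed
  then have "(\<integral>z. z $ i * cnj (z $ j) \<partial>cn_diag c) = (\<integral>z. (\<Prod>k\<in>UNIV. f k (z k)) \<partial>cn_prod c)"
    unfolding cn_diag_def by (subst integral_distr) auto
  also have "\<dots> = (\<Prod>k\<in>UNIV. \<integral>z. f k z \<partial>cn (c $ k))"
    by (rule cn.product_integral_prod) (auto simp: int)
  also have "\<dots> = 0" using cD(4)[of i] by (intro prod_zero) (auto simp: f_def intro!: exI[of _ i])
  finally show ?thesis .
qed

lemma corr_mat_cn_diag:
  assumes c: "\<And>i. 0 \<le> c $ i"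
  shows "corr_mat (cn_diag c) $ i $ j = (if i = j then of_real (c $ i) else 0)"
proof -
  have *: "z * cnj z = of_real ((cmod z)\<^sup>2)" for z by (simp only: complex_norm_square)
  show ?thesis
  proof (cases "i = j")
    case True
    then show ?thesis
      using centeredD(5)[OF centered_cn_diag_component[of c i, OF c]]
      by (simp add: corr_mat_def * del: of_real_power)
  next
    case False
    then show ?thesis using integral_cn_diag_cross[of c i j, OF c] by (simp add: corr_mat_def)
  qed
qed

lemma integrable_vec_prod:
  assumes "sets M = sets borel" "integrable M (\<lambda>u :: complex ^ 'n. (norm u)\<^sup>2)"
  shows "integrable M (\<lambda>u. u $ i * cnj (u $ j))"
proof (rule Bochner_Integration.integrable_bound[OF assms(2)])
  note [measurable_cong] = assms(1)
  show "(\<lambda>u. u $ i * cnj (u $ j)) \<in> borel_measurable M" by measurable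
  have "cmod (u $ i) * cmod (u $ j) \<le> norm u * norm u" for u :: "complex ^ 'n"
    by (intro mult_mono Finite_Cartesian_Product.norm_nth_le) auto
  then show "AE u in M. norm (u $ i * cnj (u $ j)) \<le> norm ((norm u)\<^sup>2)"
    by (simp add: norm_mult power2_eq_square)
qed

text \<open>Serves laws known only through mean and correlation matrix, such as the interference at
  the BS.\<close>

lemma centered_lincomb:
  fixes M :: "(complex ^ 'n) measure"
  assumes M: "prob_space M" "sets M = sets borel" "integrable M (\<lambda>u. (norm u)\<^sup>2)" "(\<integral>u. u \<partial>M) = 0"
  shows "centered M (\<lambda>u. \<Sum>i\<in>UNIV. b i * u $ i)
     (Re (\<Sum>i\<in>UNIV. \<Sum>j\<in>UNIV. b i * cnj (b j) * corr_mat M $ i $ j))"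
proof -
  interpret prob_space M by fact
  note [measurable_cong] = M(2)
  have id: "(\<lambda>u. u) \<in> borel_measurable M" by measurable
  have int: "integrable M (\<lambda>u. u)" using integrable_of_square_norm[OF id M(3)] .
  have int_nth: "integrable M (\<lambda>u. u $ i)" for i
    using integrable_bounded_linear[OF bounded_linear_vec_nth int] by simp
  have int0: "(\<integral>u. u $ i \<partial>M) = 0" for i
    using vec_integral_nth[OF int, of i] M(4) by simp
  have sq: "complex_of_real ((cmod (\<Sum>i\<in>UNIV. b i * u $ i))\<^sup>2)
      = (\<Sum>i\<in>UNIV. \<Sum>j\<in>UNIV. b i * cnj (b j) * (u $ i * cnj (u $ j)))" for u :: "complex ^ 'n"
    unfolding complex_norm_square cnj_sum sum_product by (simp add: algebra_simps)
  have i: "integrable M (\<lambda>u. complex_of_real ((cmod (\<Sum>i\<in>UNIV. b i * u $ i))\<^sup>2))"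
    unfolding sq by (intro Bochner_Integration.integrable_sum integrable_mult_right integrable_vec_prod M)
  have "complex_of_real (\<integral>u. (cmod (\<Sum>i\<in>UNIV. b i * u $ i))\<^sup>2 \<partial>M)
     = (\<integral>u. (\<Sum>i\<in>UNIV. \<Sum>j\<in>UNIV. b i * cnj (b j) * (u $ i * cnj (u $ j))) \<partial>M)"
    unfolding sq[symmetric] by (simp del: of_real_power)
  also have "\<dots> = (\<Sum>i\<in>UNIV. \<Sum>j\<in>UNIV. b i * cnj (b j) * corr_mat M $ i $ j)"
    by (simp add: integrable_vec_prod M corr_mat_def)
  finally have "(\<integral>u. (cmod (\<Sum>i\<in>UNIV. b i * u $ i))\<^sup>2 \<partial>M)
    = Re (\<Sum>i\<in>UNIV. \<Sum>j\<in>UNIV. b i * cnj (b j) * corr_mat M $ i $ j)" by (metis Re_complex_of_real)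
  moreover have "integrable M (\<lambda>u. (cmod (\<Sum>i\<in>UNIV. b i * u $ i))\<^sup>2)"
    using integrable_Re[OF i] by simp
  ultimately show ?thesis
    using M(1) int_nth int0 by (simp add: centered_def)
qed

lemma centered_cn_diag:
  assumes c: "\<And>i. 0 \<le> c $ i"
  shows "centered (cn_diag c) (\<lambda>z. \<Sum>i\<in>UNIV. b i * z $ i) (\<Sum>i\<in>UNIV. (cmod (b i))\<^sup>2 * c $ i)"
proof -
  interpret prob_space "cn_diag c" by simp
  have int: "integrable (cn_diag c) (\<lambda>u. u)"
    using integrable_of_square_norm[of "\<lambda>u. u"] integrable_cn_diag_sq[OF c] by simp
  have "(\<integral>u. u \<partial>cn_diag c) = 0"
    using centeredD(4)[OF centered_cn_diag_component[OF c]] by (simp add: vec_eq_iff vec_integral_nth[OF int])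
  then have "centered (cn_diag c) (\<lambda>z. \<Sum>i\<in>UNIV. b i * z $ i)
     (Re (\<Sum>i\<in>UNIV. \<Sum>j\<in>UNIV. b i * cnj (b j) * corr_mat (cn_diag c) $ i $ j))"
    by (intro centered_lincomb) (auto simp: c integrable_cn_diag_sq)
  also have "(\<Sum>i\<in>UNIV. \<Sum>j\<in>UNIV. b i * cnj (b j) * corr_mat (cn_diag c) $ i $ j)
     = (\<Sum>i\<in>UNIV. of_real ((cmod (b i))\<^sup>2 * c $ i))"
    by (simp add: corr_mat_cn_diag[OF c] complex_norm_square del: of_real_power add: if_distrib[of "(*) _"] sum.delta cong: if_cong)
  finally show ?thesis by (simp del: of_real_mult of_real_power)
qed

subsection \<open>Mutual information with additive Gaussian noise\<close>

text \<open>\<open>k t\<close> is the density of the law of \<open>t + W\<close> relative to \<open>\<nu>\<close>. The bounds make the logarithms of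
  such densities integrable against laws with finite second moments.\<close>

definition shift_density ::
  "'b::euclidean_space measure \<Rightarrow> 'a measure \<Rightarrow> ('a \<Rightarrow> 'b) \<Rightarrow> ('b \<Rightarrow> 'b \<Rightarrow> real) \<Rightarrow> bool" where
  "shift_density \<nu> N W k \<longleftrightarrow> case_prod k \<in> borel_measurable (borel \<Otimes>\<^sub>M borel)
     \<and> (\<exists>K\<ge>0. \<forall>t y. exp (- (K * (1 + (norm t)\<^sup>2 + (norm y)\<^sup>2))) \<le> k t y \<and> k t y \<le> exp (K * (1 + (norm y)\<^sup>2)))
     \<and> (\<forall>t. \<forall>g \<in> borel_measurable borel.
          (\<integral>\<^sup>+w. g (t + W w) \<partial>N) = (\<integral>\<^sup>+y. ennreal (k t y) * g y \<partial>\<nu>))"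

text \<open>The reference measure stays the same while independent terms are added to
  \<open>W\<close>, so one Gaussian component makes the entire noise comparable with a single fixed
  law.\<close>

definition noisy :: "'b::euclidean_space measure \<Rightarrow> 'a measure \<Rightarrow> ('a \<Rightarrow> 'b) \<Rightarrow> bool" where
  "noisy \<nu> N W \<longleftrightarrow> prob_space \<nu> \<and> sets \<nu> = sets borel \<and> prob_space N \<and> W \<in> borel_measurable N
     \<and> (\<exists>k. shift_density \<nu> N W k)"

lemma norm_add_sq_le: "(norm (a + b :: 'b::real_normed_vector))\<^sup>2 \<le> 2 * (norm a)\<^sup>2 + 2 * (norm b)\<^sup>2"
proof -
  have "(norm (a + b))\<^sup>2 \<le> (norm a + norm b)\<^sup>2" by (intro power_mono norm_triangle_ineq) simp
  also have "\<dots> \<le> 2 * (norm a)\<^sup>2 + 2 * (norm b)\<^sup>2"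
    using zero_le_power2[of "norm a - norm b"] by (simp add: power2_diff power2_sum)
  finally show ?thesis .
qed

lemma integrable_norm_add_sq:
  fixes f g :: "'a \<Rightarrow> 'b::{banach, second_countable_topology}"
  assumes [measurable]: "f \<in> borel_measurable M" "g \<in> borel_measurable M"
    and "integrable M (\<lambda>x. (norm (f x))\<^sup>2)" "integrable M (\<lambda>x. (norm (g x))\<^sup>2)"
  shows "integrable M (\<lambda>x. (norm (f x + g x))\<^sup>2)"
  by (rule Bochner_Integration.integrable_bound[of _ "\<lambda>x. 2 * (norm (f x))\<^sup>2 + 2 * (norm (g x))\<^sup>2"])
    (use assms norm_add_sq_le in auto)

lemma integrable_pair_norm_add_sq:
  fixes f :: "'a \<Rightarrow> 'b::{banach, second_countable_topology}"
  assumes "prob_space M" "prob_space N"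
    and f: "f \<in> borel_measurable M" "integrable M (\<lambda>x. (norm (f x))\<^sup>2)"
    and g: "g \<in> borel_measurable N" "integrable N (\<lambda>x. (norm (g x))\<^sup>2)"
  shows "integrable (M \<Otimes>\<^sub>M N) (\<lambda>(x, y). (norm (f x + g y))\<^sup>2)"
proof -
  note [measurable] = f(1) g(1)
  show ?thesis
    unfolding split_beta'
    using integral_pair_fst(1)[OF assms(2) f(2)] integral_pair_snd(1)[OF assms(1,2) g(2)]
    by (intro integrable_norm_add_sq) auto
qed

text \<open>Jensen's inequality from the tangent line of exp(-x) at the mean.\<close>

lemma (in prob_space) exp_neg_expectation_le:
  assumes X: "integrable M X" and i: "integrable M (\<lambda>x. exp (- X x :: real))"
  shows "exp (- expectation X) \<le> expectation (\<lambda>x. exp (- X x))"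
proof -
  let ?c = "expectation X"
  have "exp (- ?c) * (1 + ?c - X x) \<le> exp (- X x)" for x
  proof -
    have "1 + (?c - X x) \<le> exp (?c - X x)" by (rule exp_ge_add_one_self)
    from mult_left_mono[OF this, of "exp (- ?c)"] show ?thesis
      by (simp add: exp_add[symmetric] algebra_simps)
  qed
  then have "expectation (\<lambda>x. exp (- ?c) * (1 + ?c - X x)) \<le> expectation (\<lambda>x. exp (- X x))"
    using X i by (intro integral_mono) auto
  then show ?thesis using X by (simp add: prob_space)
qed

text \<open>The lower bound on the averaged density is Jensen's inequality for the exponential.\<close>

lemma shift_density_average:
  fixes \<nu> :: "'b::euclidean_space measure" and M :: "'c measure" and N :: "'a measure"
  assumes "prob_space M" "prob_space N" "prob_space \<nu>" "sets \<nu> = sets borel"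
    and \<phi>[measurable]: "\<phi> \<in> borel_measurable M" and i\<phi>: "integrable M (\<lambda>a. (norm (\<phi> a))\<^sup>2)"
    and W[measurable]: "W \<in> borel_measurable N"
    and k: "shift_density \<nu> N W k"
  defines "k' \<equiv> \<lambda>t y. \<integral>a. k (t + \<phi> a) y \<partial>M"
  shows "shift_density \<nu> (M \<Otimes>\<^sub>M N) (\<lambda>(a, w). \<phi> a + W w) k'"
    and "shift_density \<nu> (N \<Otimes>\<^sub>M M) (\<lambda>(w, a). W w + \<phi> a) k'"
proof -
  interpret M: prob_space M by fact
  interpret N: prob_space N by fact
  interpret \<nu>: prob_space \<nu> by fact
  interpret P: pair_prob_space M N ..
  interpret Q: pair_prob_space M \<nu> ..
  note [measurable_cong] = \<open>sets \<nu> = sets borel\<close>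
  from k obtain K where K: "K \<ge> 0"
      "\<And>t y. exp (- (K * (1 + (norm t)\<^sup>2 + (norm y)\<^sup>2))) \<le> k t y"
      "\<And>t y. k t y \<le> exp (K * (1 + (norm y)\<^sup>2))"
    and [measurable]: "case_prod k \<in> borel_measurable (borel \<Otimes>\<^sub>M borel)"
    and kW: "\<And>t g. g \<in> borel_measurable borel \<Longrightarrow>
      (\<integral>\<^sup>+w. g (t + W w) \<partial>N) = (\<integral>\<^sup>+y. ennreal (k t y) * g y \<partial>\<nu>)"
    unfolding shift_density_def by blast
  have k0: "0 \<le> k t y" for t y using K(2)[of t y] by (rule order_trans[rotated]) simp
  \<comment> \<open>The upper bound on \<open>k\<close> does not involve its first argument, so the
    integrand is bounded in \<open>a\<close> for each y.\<close>
  have ik: "integrable M (\<lambda>a. k (t + \<phi> a) y)" for t y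
    by (rule M.integrable_const_bound[of _ "exp (K * (1 + (norm y)\<^sup>2))"]) (auto simp: k0 K(3))
  have meas: "case_prod k' \<in> borel_measurable (borel \<Otimes>\<^sub>M borel)"
    unfolding k'_def by measurable
  let ?E = "\<integral>a. (norm (\<phi> a))\<^sup>2 \<partial>M"
  have E0: "?E \<ge> 0" by simp
  have upper: "k' t y \<le> exp (K * (1 + (norm y)\<^sup>2))" for t y
  proof -
    have "k' t y \<le> (\<integral>a. exp (K * (1 + (norm y)\<^sup>2)) \<partial>M)"
      unfolding k'_def by (intro integral_mono ik) (auto simp: K(3))
    then show ?thesis by (simp add: M.prob_space)
  qed
  have lower: "exp (- (K * (2 + 2 * ?E) * (1 + (norm t)\<^sup>2 + (norm y)\<^sup>2))) \<le> k' t y" for t y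
  proof -
    \<comment> \<open>The exponent of the lower bound on \<open>k (t + \<phi> a) y\<close>, with the
      squared norm of the sum replaced by 2 |t|^2 + 2 |\<phi> a|^2. Its mean is explicit and is
      dominated using the constant \<open>K * (2 + 2 * ?E)\<close>.\<close>
    let ?X = "\<lambda>a. K * (1 + (2 * (norm t)\<^sup>2 + 2 * (norm (\<phi> a))\<^sup>2) + (norm y)\<^sup>2)"
    have iX: "integrable M ?X" using i\<phi> by simp
    have ieX: "integrable M (\<lambda>a. exp (- ?X a))"
      by (rule M.integrable_const_bound[of _ 1]) (auto simp: K(1) intro!: mult_nonneg_nonneg)
    have "(1 + (2 * (norm t)\<^sup>2 + 2 * ?E) + (norm y)\<^sup>2) \<le> (2 + 2 * ?E) * (1 + (norm t)\<^sup>2 + (norm y)\<^sup>2)"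
      using E0 by (simp add: algebra_simps)
    then have "M.expectation ?X \<le> K * (2 + 2 * ?E) * (1 + (norm t)\<^sup>2 + (norm y)\<^sup>2)"
      using i\<phi> K(1) by (simp add: M.prob_space mult.assoc mult_left_mono)
    then have "exp (- (K * (2 + 2 * ?E) * (1 + (norm t)\<^sup>2 + (norm y)\<^sup>2))) \<le> exp (- M.expectation ?X)"
      by simp
    also have "\<dots> \<le> M.expectation (\<lambda>a. exp (- ?X a))"
      by (rule M.exp_neg_expectation_le[OF iX ieX])
    also have "\<dots> \<le> k' t y"
      unfolding k'_def
    proof (intro integral_mono ieX ik)
      fix a
      have "exp (- ?X a) \<le> exp (- (K * (1 + (norm (t + \<phi> a))\<^sup>2 + (norm y)\<^sup>2)))"
        using norm_add_sq_le[of t "\<phi> a"] K(1) by (simp add: mult_left_mono)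
      also have "\<dots> \<le> k (t + \<phi> a) y" by (rule K(2))
      finally show "exp (- ?X a) \<le> k (t + \<phi> a) y" .
    qed
    finally show ?thesis .
  qed
  have bounds: "\<exists>K'\<ge>0. \<forall>t y. exp (- (K' * (1 + (norm t)\<^sup>2 + (norm y)\<^sup>2))) \<le> k' t y
      \<and> k' t y \<le> exp (K' * (1 + (norm y)\<^sup>2))"
  proof (intro exI[of _ "K * (2 + 2 * ?E)"] conjI allI lower)
    show "0 \<le> K * (2 + 2 * ?E)" using K(1) E0 by simp
    fix t y :: 'b
    have "K * 1 \<le> K * (2 + 2 * ?E)" using K(1) E0 by (intro mult_left_mono) auto
    then have "K * (1 + (norm y)\<^sup>2) \<le> K * (2 + 2 * ?E) * (1 + (norm y)\<^sup>2)"
      by (intro mult_right_mono) auto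
    with upper[of t y] show "k' t y \<le> exp (K * (2 + 2 * ?E) * (1 + (norm y)\<^sup>2))"
      by (meson exp_le_cancel_iff order_trans)
  qed
  have int: "(\<integral>\<^sup>+a. \<integral>\<^sup>+w. g (t + \<phi> a + W w) \<partial>N \<partial>M) = (\<integral>\<^sup>+y. ennreal (k' t y) * g y \<partial>\<nu>)"
    if [measurable]: "g \<in> borel_measurable borel" for g t
  proof -
    have "(\<integral>\<^sup>+a. \<integral>\<^sup>+w. g (t + \<phi> a + W w) \<partial>N \<partial>M) = (\<integral>\<^sup>+a. \<integral>\<^sup>+y. ennreal (k (t + \<phi> a) y) * g y \<partial>\<nu> \<partial>M)"
      by (simp add: kW)
    also have "\<dots> = (\<integral>\<^sup>+y. \<integral>\<^sup>+a. ennreal (k (t + \<phi> a) y) * g y \<partial>M \<partial>\<nu>)"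
      by (rule Q.Fubini'[symmetric]) measurable
    also have "\<dots> = (\<integral>\<^sup>+y. ennreal (k' t y) * g y \<partial>\<nu>)"
      unfolding k'_def
      by (intro nn_integral_cong) (subst nn_integral_multc, auto simp: nn_integral_eq_integral ik k0)
    finally show ?thesis .
  qed
  show "shift_density \<nu> (M \<Otimes>\<^sub>M N) (\<lambda>(a, w). \<phi> a + W w) k'"
    unfolding shift_density_def
  proof (intro conjI meas bounds allI ballI)
    fix t and g :: "'b \<Rightarrow> ennreal" assume [measurable]: "g \<in> borel_measurable borel"
    have "(\<integral>\<^sup>+x. g (t + (case x of (a, w) \<Rightarrow> \<phi> a + W w)) \<partial>(M \<Otimes>\<^sub>M N))
       = (\<integral>\<^sup>+a. \<integral>\<^sup>+w. g (t + \<phi> a + W w) \<partial>N \<partial>M)"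
      by (subst N.nn_integral_fst[symmetric]) (auto simp: add.assoc split_beta')
    then show "(\<integral>\<^sup>+x. g (t + (case x of (a, w) \<Rightarrow> \<phi> a + W w)) \<partial>(M \<Otimes>\<^sub>M N))
       = (\<integral>\<^sup>+y. ennreal (k' t y) * g y \<partial>\<nu>)" by (simp add: int)
  qed
  \<comment> \<open>The mirrored order of factors serves interference, which stands to the right of
    the thermal noise in the channel laws.\<close>
  show "shift_density \<nu> (N \<Otimes>\<^sub>M M) (\<lambda>(w, a). W w + \<phi> a) k'"
    unfolding shift_density_def
  proof (intro conjI meas bounds allI ballI)
    fix t and g :: "'b \<Rightarrow> ennreal" assume [measurable]: "g \<in> borel_measurable borel"
    have "(\<integral>\<^sup>+x. g (t + (case x of (w, a) \<Rightarrow> W w + \<phi> a)) \<partial>(N \<Otimes>\<^sub>M M))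
       = (\<integral>\<^sup>+w. \<integral>\<^sup>+a. g (t + \<phi> a + W w) \<partial>M \<partial>N)"
      by (subst M.nn_integral_fst[symmetric]) (auto simp: ac_simps split_beta')
    also have "\<dots> = (\<integral>\<^sup>+a. \<integral>\<^sup>+w. g (t + \<phi> a + W w) \<partial>N \<partial>M)"
      by (rule P.Fubini') measurable
    finally show "(\<integral>\<^sup>+x. g (t + (case x of (w, a) \<Rightarrow> W w + \<phi> a)) \<partial>(N \<Otimes>\<^sub>M M))
       = (\<integral>\<^sup>+y. ennreal (k' t y) * g y \<partial>\<nu>)" by (simp add: int)
  qed
qed

lemma noisy_pair:
  assumes "prob_space M" "\<phi> \<in> borel_measurable M" "integrable M (\<lambda>a. (norm (\<phi> a))\<^sup>2)"
    and W: "noisy \<nu> N W"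
  shows "noisy \<nu> (M \<Otimes>\<^sub>M N) (\<lambda>(a, w). \<phi> a + W w)"
    and "noisy \<nu> (N \<Otimes>\<^sub>M M) (\<lambda>(w, a). W w + \<phi> a)"
proof -
  from W obtain k where k: "prob_space N" "prob_space \<nu>" "sets \<nu> = sets borel" "W \<in> borel_measurable N"
    "shift_density \<nu> N W k" by (auto simp: noisy_def)
  note [measurable] = assms(2) k(4)
  note * = shift_density_average[OF assms(1) k(1,2,3) assms(2,3) k(4,5)]
  show "noisy \<nu> (M \<Otimes>\<^sub>M N) (\<lambda>(a, w). \<phi> a + W w)" "noisy \<nu> (N \<Otimes>\<^sub>M M) (\<lambda>(w, a). W w + \<phi> a)"
    unfolding noisy_def using * by (auto intro!: prob_space_pair simp: k assms(1))
qed

lemma noisy_self: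
  fixes \<nu> :: "'b::euclidean_space measure"
  assumes \<nu>: "prob_space \<nu>" "sets \<nu> = sets borel" and v: "0 < v"
    and shift: "\<And>g t. g \<in> borel_measurable borel \<Longrightarrow>
      (\<integral>\<^sup>+z. g (t + z) \<partial>\<nu>) = (\<integral>\<^sup>+z. ennreal (exp ((2 * (t \<bullet> z) - (norm t)\<^sup>2) / v)) * g z \<partial>\<nu>)"
  shows "noisy \<nu> \<nu> (\<lambda>z. z)"
proof -
  note [measurable_cong] = \<nu>(2)
  \<comment> \<open>2 t.y - |t|^2 equals |y|^2 - |t - y|^2, hence is at most |y|^2, a bound free of
    t; from below it is at least -2 |t|^2 - |y|^2. Both fit the constant 2 / v.\<close>
  have b: "(2 * (t \<bullet> y) - (norm t)\<^sup>2) / v \<le> 2 / v * (1 + (norm y)\<^sup>2)"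
      "- (2 / v * (1 + (norm t)\<^sup>2 + (norm y)\<^sup>2)) \<le> (2 * (t \<bullet> y) - (norm t)\<^sup>2) / v" for t y :: 'b
  proof -
    have "(norm (t - y))\<^sup>2 \<ge> 0" "(norm (t + y))\<^sup>2 \<ge> 0" by simp_all
    then have *: "2 * (t \<bullet> y) \<le> (norm t)\<^sup>2 + (norm y)\<^sup>2" "- ((norm t)\<^sup>2 + (norm y)\<^sup>2) \<le> 2 * (t \<bullet> y)"
      by (simp_all add: power2_norm_eq_inner inner_simps inner_commute)
    have "2 * (t \<bullet> y) - (norm t)\<^sup>2 \<le> 2 * (1 + (norm y)\<^sup>2)"
      using *(1) by (smt (verit) zero_le_power2)
    from divide_right_mono[OF this, of v] show "(2 * (t \<bullet> y) - (norm t)\<^sup>2) / v \<le> 2 / v * (1 + (norm y)\<^sup>2)"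
      using v by simp
    have "- (2 * (1 + (norm t)\<^sup>2 + (norm y)\<^sup>2)) \<le> 2 * (t \<bullet> y) - (norm t)\<^sup>2"
      using *(2) by (smt (verit) zero_le_power2)
    from divide_right_mono[OF this, of v]
    show "- (2 / v * (1 + (norm t)\<^sup>2 + (norm y)\<^sup>2)) \<le> (2 * (t \<bullet> y) - (norm t)\<^sup>2) / v"
      using v by (simp only: times_divide_eq_left minus_divide_left less_imp_le)
  qed
  have "shift_density \<nu> \<nu> (\<lambda>z. z) (\<lambda>t y. exp ((2 * (t \<bullet> y) - (norm t)\<^sup>2) / v))"
    unfolding shift_density_def
  proof (intro conjI exI[of _ "2 / v"] allI ballI)
    show "(\<lambda>(t, y). exp ((2 * (t \<bullet> y) - (norm t)\<^sup>2) / v)) \<in> borel_measurable (borel \<Otimes>\<^sub>M (borel :: 'b measure))"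
      by measurable
  qed (use v b shift in auto)
  then show ?thesis unfolding noisy_def using \<nu> by auto
qed

text \<open>Donsker-Varadhan bound: \<open>ln t \<le> t - 1\<close> applied to \<open>exp T / r\<close>, where \<open>r\<close> is the density of the
  joint law with respect to the product of its marginals. The exponential bounds on the shift
  densities make \<open>ln r\<close> integrable, so the mutual information is not a junk value.\<close>

lemma mutual_information_ge:
  fixes f :: "'a::euclidean_space measure" and u :: "'a \<Rightarrow> 'b::euclidean_space"
  assumes f: "prob_space f" "sets f = sets borel"
    and u[measurable]: "u \<in> borel_measurable borel" and iu: "integrable f (\<lambda>x. (norm (u x))\<^sup>2)"
    and W: "noisy \<nu> N W" and iW: "integrable N (\<lambda>w. (norm (W w))\<^sup>2)"
    and T[measurable]: "T \<in> borel_measurable (borel \<Otimes>\<^sub>M borel)"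
    and iT: "integrable (f \<Otimes>\<^sub>M N) (\<lambda>(x, w). T (x, u x + W w))"
    and expT: "\<And>y. (\<integral>\<^sup>+x. ennreal (exp (T (x, y))) \<partial>f) \<le> 1"
  shows "(\<integral>(x, w). T (x, u x + W w) \<partial>(f \<Otimes>\<^sub>M N)) / ln 2
    \<le> prob_space.mutual_information (f \<Otimes>\<^sub>M N) 2 borel borel fst (\<lambda>(x, w). u x + W w)"
proof -
  note [measurable_cong] = f(2)
  from W have \<nu>: "prob_space \<nu>" "sets \<nu> = sets borel" and N: "prob_space N" and [measurable]: "W \<in> borel_measurable N"
    by (auto simp: noisy_def)
  note [measurable_cong] = \<nu>(2)
  interpret f: prob_space f by fact
  interpret N: prob_space N by fact
  interpret \<nu>: prob_space \<nu> by fact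
  interpret fN: pair_prob_space f N ..
  have [measurable]: "u \<in> borel_measurable f" by simp
  obtain k K where K: "K \<ge> 0"
      "\<And>t y. exp (- (K * (1 + (norm t)\<^sup>2 + (norm y)\<^sup>2))) \<le> k t y"
      "\<And>t y. k t y \<le> exp (K * (1 + (norm y)\<^sup>2))"
    and [measurable]: "case_prod k \<in> borel_measurable (borel \<Otimes>\<^sub>M borel)"
    and kW: "\<And>t g. g \<in> borel_measurable borel \<Longrightarrow>
      (\<integral>\<^sup>+w. g (t + W w) \<partial>N) = (\<integral>\<^sup>+y. ennreal (k t y) * g y \<partial>\<nu>)"
    using W unfolding noisy_def shift_density_def by blast
  \<comment> \<open>The signal counts as one more independent summand. The output thus has a density
    relative to the same \<open>\<nu>\<close>, namely the shift density at shift 0, and it inherits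
    the exponential bounds.\<close>
  have "noisy \<nu> (f \<Otimes>\<^sub>M N) (\<lambda>(x, w). u x + W w)"
    by (rule noisy_pair(1)[OF f(1) _ iu W]) simp
  then obtain k2 K2 where K2: "K2 \<ge> 0"
      "\<And>t y. exp (- (K2 * (1 + (norm t)\<^sup>2 + (norm y)\<^sup>2))) \<le> k2 t y"
      "\<And>t y. k2 t y \<le> exp (K2 * (1 + (norm y)\<^sup>2))"
    and [measurable]: "case_prod k2 \<in> borel_measurable (borel \<Otimes>\<^sub>M borel)"
    and k2W: "\<And>t g. g \<in> borel_measurable borel \<Longrightarrow>
      (\<integral>\<^sup>+x. g (t + (case x of (x, w) \<Rightarrow> u x + W w)) \<partial>(f \<Otimes>\<^sub>M N)) = (\<integral>\<^sup>+y. ennreal (k2 t y) * g y \<partial>\<nu>)"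
    unfolding noisy_def shift_density_def by blast
  define m where "m y = k2 0 y" for y
  have [measurable]: "m \<in> borel_measurable borel" unfolding m_def by measurable
  have k0: "0 < k t y" for t y using K(2)[of t y] by (rule less_le_trans[rotated]) simp
  have m0: "0 < m y" for y unfolding m_def using K2(2)[of 0 y] by (rule less_le_trans[rotated]) simp
  define Y where "Y = (\<lambda>(x, w). u x + W w)"
  have [measurable]: "Y \<in> borel_measurable (f \<Otimes>\<^sub>M N)" unfolding Y_def by measurable
  have Xd: "distr (f \<Otimes>\<^sub>M N) borel fst = f"
    using N.distr_pair_fst[of f] distr_cong[of "f \<Otimes>\<^sub>M N" "f \<Otimes>\<^sub>M N" borel f fst fst] f(2) by simp
  have Yd: "distr (f \<Otimes>\<^sub>M N) borel Y = density \<nu> (\<lambda>y. ennreal (m y))"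
  proof (rule measure_eqI)
    fix A assume "A \<in> sets (distr (f \<Otimes>\<^sub>M N) borel Y)"
    then have [measurable]: "A \<in> sets borel" by simp
    have "emeasure (distr (f \<Otimes>\<^sub>M N) borel Y) A = (\<integral>\<^sup>+x. indicator A x \<partial>distr (f \<Otimes>\<^sub>M N) borel Y)"
      by simp
    also have "\<dots> = (\<integral>\<^sup>+x. indicator A (0 + Y x) \<partial>(f \<Otimes>\<^sub>M N))"
      by (subst nn_integral_distr) auto
    also have "\<dots> = (\<integral>\<^sup>+y. ennreal (m y) * indicator A y \<partial>\<nu>)"
      unfolding Y_def m_def by (rule k2W) simp
    finally show "emeasure (distr (f \<Otimes>\<^sub>M N) borel Y) A = emeasure (density \<nu> (\<lambda>y. ennreal (m y))) A"
      by (simp add: emeasure_density)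
  qed (simp add: \<nu>(2))
  define B where "B = f \<Otimes>\<^sub>M distr (f \<Otimes>\<^sub>M N) borel Y"
  define J where "J = distr (f \<Otimes>\<^sub>M N) (borel \<Otimes>\<^sub>M borel) (\<lambda>x. (fst x, Y x))"
  have sets_B[simp, measurable_cong]: "sets B = sets (borel \<Otimes>\<^sub>M borel)"
    unfolding B_def by (intro sets_pair_measure_cong) (auto simp: f(2))
  have sets_J[simp, measurable_cong]: "sets J = sets (borel \<Otimes>\<^sub>M borel)"
    unfolding J_def by simp
  interpret Y: prob_space "distr (f \<Otimes>\<^sub>M N) borel Y"
    by (rule fN.prob_space_distr) simp
  interpret fY: pair_prob_space f "distr (f \<Otimes>\<^sub>M N) borel Y" ..
  have nnB: "(\<integral>\<^sup>+z. g z \<partial>B) = (\<integral>\<^sup>+x. \<integral>\<^sup>+y. ennreal (m y) * g (x, y) \<partial>\<nu> \<partial>f)"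
    if [measurable]: "g \<in> borel_measurable (borel \<Otimes>\<^sub>M borel)" for g
    unfolding B_def by (subst Y.nn_integral_fst[symmetric]) (simp_all add: Yd nn_integral_density)
  have nnJ: "(\<integral>\<^sup>+z. g z \<partial>J) = (\<integral>\<^sup>+x. \<integral>\<^sup>+y. ennreal (k (u x) y) * g (x, y) \<partial>\<nu> \<partial>f)"
    if [measurable]: "g \<in> borel_measurable (borel \<Otimes>\<^sub>M borel)" for g
  proof -
    have "(\<integral>\<^sup>+z. g z \<partial>J) = (\<integral>\<^sup>+x. g (fst x, Y x) \<partial>(f \<Otimes>\<^sub>M N))"
      unfolding J_def by (subst nn_integral_distr) auto
    also have "\<dots> = (\<integral>\<^sup>+x. \<integral>\<^sup>+w. g (x, u x + W w) \<partial>N \<partial>f)"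
      unfolding Y_def by (subst N.nn_integral_fst[symmetric]) (auto simp: split_beta')
    also have "\<dots> = (\<integral>\<^sup>+x. \<integral>\<^sup>+y. ennreal (k (u x) y) * g (x, y) \<partial>\<nu> \<partial>f)"
      by (intro nn_integral_cong kW) measurable
    finally show ?thesis .
  qed
  \<comment> \<open>The density of input and output jointly, relative to the product of their
    marginals: conditional output density over marginal output density, the reference
    \<open>\<nu>\<close> cancelling.\<close>
  define r where "r = (\<lambda>(x, y). k (u x) y / m y)"
  have r[measurable]: "r \<in> borel_measurable (borel \<Otimes>\<^sub>M borel)" unfolding r_def by measurable
  have r0: "0 < r z" for z by (auto simp: r_def k0 m0 split: prod.split)
  have JB: "J = density B (\<lambda>z. ennreal (r z))"
  proof (rule measure_eqI)
    fix A assume "A \<in> sets J"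
    then have [measurable]: "A \<in> sets (borel \<Otimes>\<^sub>M borel)" by simp
    have "emeasure J A = (\<integral>\<^sup>+z. indicator A z \<partial>J)" by simp
    also have "\<dots> = (\<integral>\<^sup>+x. \<integral>\<^sup>+y. ennreal (k (u x) y) * indicator A (x, y) \<partial>\<nu> \<partial>f)"
      by (rule nnJ) simp
    also have "\<dots> = (\<integral>\<^sup>+x. \<integral>\<^sup>+y. ennreal (m y) * (ennreal (r (x, y)) * indicator A (x, y)) \<partial>\<nu> \<partial>f)"
    proof (intro nn_integral_cong)
      fix x y
      have "ennreal (k (u x) y) = ennreal (m y) * ennreal (r (x, y))"
        using m0[of y] k0[of "u x" y] by (subst ennreal_mult[symmetric]) (auto simp: r_def less_imp_le)
      then show "ennreal (k (u x) y) * indicator A (x, y) = ennreal (m y) * (ennreal (r (x, y)) * indicator A (x, y))"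
        by (simp add: mult.assoc)
    qed
    also have "\<dots> = (\<integral>\<^sup>+z. ennreal (r z) * indicator A z \<partial>B)"
      by (rule nnB[symmetric]) measurable
    finally show "emeasure J A = emeasure (density B (\<lambda>z. ennreal (r z))) A"
      by (simp add: emeasure_density)
  qed simp
  interpret B: prob_space B unfolding B_def by (rule fY.prob_space_axioms)
  interpret J: prob_space J unfolding J_def by (rule fN.prob_space_distr) simp
  have mi: "prob_space.mutual_information (f \<Otimes>\<^sub>M N) 2 borel borel fst Y = (\<integral>z. ln (r z) \<partial>J) / ln 2"
  proof -
    have "prob_space.mutual_information (f \<Otimes>\<^sub>M N) 2 borel borel fst Y = KL_divergence 2 B J"
      unfolding fN.mutual_information_def B_def J_def Xd ..
    also have "\<dots> = (\<integral>z. r z * log 2 (r z) \<partial>B)"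
      unfolding JB by (rule B.KL_density) (auto simp: r0 less_imp_le)
    also have "\<dots> = (\<integral>z. log 2 (r z) \<partial>J)"
      unfolding JB by (subst integral_density) (auto simp: r0 less_imp_le)
    finally show ?thesis by (simp add: log_def)
  qed
  have iJ: "integrable J g \<longleftrightarrow> integrable (f \<Otimes>\<^sub>M N) (\<lambda>(x, w). g (x, u x + W w))"
    "(\<integral>z. g z \<partial>J) = (\<integral>(x, w). g (x, u x + W w) \<partial>(f \<Otimes>\<^sub>M N))"
    if [measurable]: "g \<in> borel_measurable (borel \<Otimes>\<^sub>M borel)" for g :: "'a \<times> 'b \<Rightarrow> real"
    unfolding J_def by (simp_all add: integrable_distr_eq integral_distr Y_def split_beta')
  have i1: "integrable J (\<lambda>z. (norm (u (fst z)))\<^sup>2)"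
    by (subst iJ) (simp_all add: split_beta' integral_pair_fst(1)[OF N iu])
  have i2: "integrable J (\<lambda>z. (norm (snd z))\<^sup>2)"
    by (subst iJ) (simp_all add: integrable_pair_norm_add_sq[OF f(1) N _ iu _ iW])
  have iln: "integrable J (\<lambda>z. ln (r z))"
  proof (rule Bochner_Integration.integrable_bound)
    show "integrable J (\<lambda>z. K * (1 + (norm (u (fst z)))\<^sup>2 + (norm (snd z))\<^sup>2) + K2 * (1 + (norm (snd z))\<^sup>2))"
      using i1 i2 by simp
    have "\<bar>ln (r (x, y))\<bar> \<le> K * (1 + (norm (u x))\<^sup>2 + (norm y)\<^sup>2) + K2 * (1 + (norm y)\<^sup>2)" for x y
    proof -
      have "ln (k (u x) y) \<le> ln (exp (K * (1 + (norm y)\<^sup>2)))"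
        by (subst ln_le_cancel_iff) (auto simp: k0 K(3))
      moreover have "ln (exp (- (K * (1 + (norm (u x))\<^sup>2 + (norm y)\<^sup>2)))) \<le> ln (k (u x) y)"
        by (subst ln_le_cancel_iff) (auto simp only: k0 K(2) exp_gt_zero)
      moreover have "ln (m y) \<le> ln (exp (K2 * (1 + (norm y)\<^sup>2)))"
        by (subst ln_le_cancel_iff) (auto simp: m0, auto simp: m_def K2(3))
      moreover have "ln (exp (- (K2 * (1 + (norm (0 :: 'b))\<^sup>2 + (norm y)\<^sup>2)))) \<le> ln (m y)"
        by (subst ln_le_cancel_iff) (auto simp only: m0 exp_gt_zero, simp only: m_def K2(2))
      moreover have "K * (1 + (norm y)\<^sup>2) \<le> K * (1 + (norm (u x))\<^sup>2 + (norm y)\<^sup>2)"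
        using K(1) by (intro mult_left_mono) auto
      moreover have "ln (r (x, y)) = ln (k (u x) y) - ln (m y)"
        using k0[of "u x" y] m0[of y] by (simp add: r_def ln_div)
      ultimately show ?thesis by simp
    qed
    then show "AE z in J. norm (ln (r z)) \<le>
      norm (K * (1 + (norm (u (fst z)))\<^sup>2 + (norm (snd z))\<^sup>2) + K2 * (1 + (norm (snd z))\<^sup>2))"
      by (intro AE_I2) (force intro: order_trans[OF _ abs_ge_self])
  qed simp
  have iTJ: "integrable J T" by (subst iJ) (auto simp: iT)
  have "(\<integral>\<^sup>+z. ennreal (exp (T z) / r z) \<partial>J) = (\<integral>\<^sup>+z. ennreal (r z) * ennreal (exp (T z) / r z) \<partial>B)"
    unfolding JB by (subst nn_integral_density) auto
  also have "\<dots> = (\<integral>\<^sup>+z. ennreal (exp (T z)) \<partial>B)"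
  proof (intro nn_integral_cong)
    fix z show "ennreal (r z) * ennreal (exp (T z) / r z) = ennreal (exp (T z))"
      using r0[of z] by (subst ennreal_mult[symmetric]) (auto simp: less_imp_le)
  qed
  \<comment> \<open>Under the product law the output may be integrated last, so that
    \<open>expT\<close> applies for each fixed y.\<close>
  also have "\<dots> = (\<integral>\<^sup>+y. \<integral>\<^sup>+x. ennreal (exp (T (x, y))) \<partial>f \<partial>distr (f \<Otimes>\<^sub>M N) borel Y)"
    unfolding B_def by (rule fY.nn_integral_snd[symmetric]) simp
  also have "\<dots> \<le> (\<integral>\<^sup>+y. 1 \<partial>distr (f \<Otimes>\<^sub>M N) borel Y)"
    by (intro nn_integral_mono expT)
  finally have e1: "(\<integral>\<^sup>+z. ennreal (exp (T z) / r z) \<partial>J) \<le> 1"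
    by (simp add: Y.emeasure_space_1[simplified])
  have ie: "integrable J (\<lambda>z. exp (T z) / r z)"
    using e1 r0 by (intro integrableI_bounded) (auto simp: less_imp_le intro: le_less_trans)
  have e1': "(\<integral>z. exp (T z) / r z \<partial>J) \<le> 1"
    using e1 by (subst (asm) nn_integral_eq_integral[OF ie]) (auto simp: r0 less_imp_le)
  have "(\<integral>z. T z - ln (r z) \<partial>J) \<le> (\<integral>z. exp (T z) / r z - 1 \<partial>J)"
  proof (rule integral_mono)
    fix z
    have "ln (exp (T z) / r z) \<le> exp (T z) / r z - 1" using r0[of z] by (intro ln_le_minus_one) simp
    then show "T z - ln (r z) \<le> exp (T z) / r z - 1" using r0[of z] by (simp add: ln_div)
  qed (use iTJ iln ie in auto)
  also have "\<dots> \<le> 0" using e1' ie by (simp add: J.prob_space)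
  finally have "(\<integral>z. T z \<partial>J) \<le> (\<integral>z. ln (r z) \<partial>J)" using iTJ iln by simp
  then have "(\<integral>(x, w). T (x, u x + W w) \<partial>(f \<Otimes>\<^sub>M N)) / ln 2 \<le> (\<integral>z. ln (r z) \<partial>J) / ln 2"
    by (simp add: iJ divide_right_mono)
  then show ?thesis using mi by (simp add: Y_def)
qed

text \<open>The test function is the log-density of CN(\<eta> y, e) relative to the law CN(0, p) of
  \<xi>; its mean is explicit because \<xi> has power p and the error has power q. The scalar \<xi>
  is a function of the input because the downlink input is a vector driven by one Gaussian symbol.
  The estimate \<eta> may be any Borel function of the output, which leaves room for receive
  combining.\<close>

lemma linear_estimate_mutual_information_ge:
  fixes f :: "'a::euclidean_space measure" and u :: "'a \<Rightarrow> 'b::euclidean_space"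
    and \<xi> :: "'a \<Rightarrow> complex" and \<eta> :: "'b \<Rightarrow> complex"
  assumes f: "prob_space f" "sets f = sets borel"
    and u[measurable]: "u \<in> borel_measurable borel" and iu: "integrable f (\<lambda>x. (norm (u x))\<^sup>2)"
    and W: "noisy \<nu> N W" and iW: "integrable N (\<lambda>w. (norm (W w))\<^sup>2)"
    and p: "0 < p" and e: "0 < e"
    and \<xi>[measurable]: "\<xi> \<in> borel_measurable borel" and \<eta>[measurable]: "\<eta> \<in> borel_measurable borel"
    and \<xi>_law: "distr f borel \<xi> = cn p"
    and err: "centered (f \<Otimes>\<^sub>M N) (\<lambda>(x, w). \<xi> x - \<eta> (u x + W w)) q"
  shows "(ln (p / e) + 1 - q / e) / ln 2
    \<le> prob_space.mutual_information (f \<Otimes>\<^sub>M N) 2 borel borel fst (\<lambda>(x, w). u x + W w)"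
proof -
  note [measurable_cong] = f(2)
  from W have N: "prob_space N" and [measurable]: "W \<in> borel_measurable N"
    by (auto simp: noisy_def)
  interpret f: prob_space f by fact
  interpret N: prob_space N by fact
  interpret fN: pair_prob_space f N ..
  define T where "T = (\<lambda>(x, y). ln (p / e) + (norm (\<xi> x))\<^sup>2 / p - (norm (\<xi> x - \<eta> y))\<^sup>2 / e)"
  have T[measurable]: "T \<in> borel_measurable (borel \<Otimes>\<^sub>M borel)" unfolding T_def by measurable
  have "centered f \<xi> p"
    using centered_cn[OF less_imp_le[OF p]] unfolding \<xi>_law[symmetric]
    by (subst (asm) centered_distr) (auto simp: f)
  note \<xi>D = centeredD[OF this]
  note \<xi>2 = integral_pair_fst[OF N \<xi>D(3)]
  note errD = centeredD(3,5)[OF err]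
  have TY: "(\<lambda>(x, w). T (x, u x + W w)) = (\<lambda>z. ln (p / e) + (norm (\<xi> (fst z)))\<^sup>2 / p
      - (cmod (case z of (x, w) \<Rightarrow> \<xi> x - \<eta> (u x + W w)))\<^sup>2 / e)"
    by (auto simp: T_def)
  have iT: "integrable (f \<Otimes>\<^sub>M N) (\<lambda>(x, w). T (x, u x + W w))"
    unfolding TY using errD(1) \<xi>2(1) by simp
  have "(\<integral>(x, w). T (x, u x + W w) \<partial>(f \<Otimes>\<^sub>M N)) = ln (p / e) + 1 - q / e"
    unfolding TY using errD \<xi>2 p \<xi>D(5) by (simp add: fN.prob_space)
  moreover have "(\<integral>\<^sup>+x. ennreal (exp (T (x, y))) \<partial>f) \<le> 1" for y
  proof -
    have "(\<integral>\<^sup>+x. ennreal (exp (T (x, y))) \<partial>f)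
       = (\<integral>\<^sup>+z. ennreal (exp (ln (p / e) + (norm z)\<^sup>2 / p - (norm (z - \<eta> y))\<^sup>2 / e)) \<partial>distr f borel \<xi>)"
      by (subst nn_integral_distr) (auto simp: T_def)
    also have "\<dots> = 1" unfolding \<xi>_law by (rule nn_integral_cn_tilt[OF p e])
    finally show ?thesis by simp
  qed
  note mutual_information_ge[OF f u iu W iW T iT this]
  ultimately show ?thesis by simp
qed

subsection \<open>Downlink and uplink for fixed realizations\<close>

lemma bilin_add [simp]: "bilin h (x + y) = bilin h x + bilin h y"
  by (simp add: bilin_def algebra_simps sum.distrib)

lemma herm_add [simp]: "herm h (x + y) = herm h x + herm h y"
  by (simp add: herm_def algebra_simps sum.distrib)

lemma herm_scale [simp]: "herm h (c *s x) = c * herm h x"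
  by (simp add: herm_def sum_distrib_left algebra_simps)

lemma cnj_herm: "cnj (herm x y) = herm y x"
  by (simp add: herm_def algebra_simps)

lemma herm_self: "herm v v = of_real ((norm v)\<^sup>2)"
  by (simp add: herm_def norm_vec_sq complex_norm_square del: of_real_power) (simp add: algebra_simps)

lemma borel_measurable_bilin [measurable (raw)]:
  "f \<in> borel_measurable M \<Longrightarrow> g \<in> borel_measurable M \<Longrightarrow> (\<lambda>x. bilin (f x) (g x)) \<in> borel_measurable M"
  unfolding bilin_def by (intro borel_measurable_sum borel_measurable_times borel_measurable_vec_nth)

lemma borel_measurable_herm [measurable (raw)]:
  "f \<in> borel_measurable M \<Longrightarrow> g \<in> borel_measurable M \<Longrightarrow> (\<lambda>x. herm (f x) (g x)) \<in> borel_measurable M"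
  unfolding herm_def by (intro borel_measurable_sum borel_measurable_times borel_measurable_cnj borel_measurable_vec_nth)

lemma borel_measurable_cvec [measurable (raw)]:
  "f \<in> borel_measurable M \<Longrightarrow> (\<lambda>x. cvec (f x)) \<in> borel_measurable M"
  unfolding cvec_def by (intro borel_measurable_vec_lambda borel_measurable_cnj borel_measurable_vec_nth)

lemma borel_measurable_vector_scale [measurable (raw)]:
  "c \<in> borel_measurable M \<Longrightarrow> f \<in> borel_measurable M \<Longrightarrow> (\<lambda>x. c x *s (f x :: complex ^ 'n)) \<in> borel_measurable M"
  unfolding vector_scalar_mult_def by (intro borel_measurable_vec_lambda borel_measurable_times borel_measurable_vec_nth)

lemma measurable_scale_cn [simp]: "(\<lambda>x. x *s (v :: complex ^ 'n)) \<in> borel_measurable (cn p)"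
  by (intro borel_measurable_vector_scale) (auto simp: measurable_cong_sets[OF sets_cn refl])

lemma norm_vector_scale: "norm (c *s (x :: complex ^ 'n)) = cmod c * norm x"
proof -
  have "(norm (c *s x))\<^sup>2 = (cmod c * norm x)\<^sup>2"
    by (simp add: norm_vec_sq norm_mult power_mult_distrib sum_distrib_left)
  then show ?thesis by (simp add: power2_eq_iff_nonneg)
qed

lemma norm_cvec [simp]: "norm (cvec x) = norm x"
  by (simp add: norm_vec_def cvec_def)

section \<open>Downlink\<close>

definition beam_law :: "real \<Rightarrow> complex ^ 'n \<Rightarrow> (complex ^ 'n) measure" where
  "beam_law p v = distr (cn p) borel (\<lambda>x. x *s cvec v)"

lemma beam_law:
  assumes p: "0 < p" and v: "norm v = 1"
  shows "prob_space (beam_law p v)" "sets (beam_law p v) = sets borel"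
    "corr_mat (beam_law p v) $ i $ j = of_real p * cnj (v $ i) * v $ j"
    "dl_input p (beam_law p v)"
proof -
  note c = centeredD[OF centered_cn[OF less_imp_le[OF p]]]
  show "prob_space (beam_law p v)" "sets (beam_law p v) = sets borel"
    unfolding beam_law_def by (auto intro!: prob_space.prob_space_distr)
  have sq: "complex_of_real ((cmod x)\<^sup>2) = x * cnj x" for x by (rule complex_norm_square)
  have "corr_mat (beam_law p v) $ i $ j = (\<integral>x. complex_of_real ((cmod x)\<^sup>2) * (cnj (v $ i) * v $ j) \<partial>cn p)"
    unfolding corr_mat_def beam_law_def by (simp add: integral_distr cvec_def sq ac_simps del: of_real_power)
  also have "\<dots> = of_real p * cnj (v $ i) * v $ j"
    by (simp add: c(3,5) del: of_real_power)
  finally show "corr_mat (beam_law p v) $ i $ j = of_real p * cnj (v $ i) * v $ j" .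
  have i: "integrable (cn p) (\<lambda>x. x *s cvec v)"
  proof (rule prob_space.integrable_of_square_norm[OF prob_space_cn])
    show "integrable (cn p) (\<lambda>x. (norm (x *s cvec v))\<^sup>2)"
      using c(3) by (simp add: norm_vector_scale v)
  qed simp
  have "(\<integral>x. x *s cvec v \<partial>cn p) = 0"
    by (simp add: vec_eq_iff vec_integral_nth[OF i] c(4,6))
  then show "dl_input p (beam_law p v)"
    unfolding dl_input_def beam_law_def
    by (simp add: integrable_distr_eq integral_distr norm_vector_scale v c(3,5))
qed

text \<open>Received power of signal and distortions per unit of transmit power, after beamforming
  or combining. The coefficient k belongs to the single-antenna UE and k' to the BS in both
  directions, which lets both links share the averaging argument.\<close>

definition second_moment_gain :: "real \<Rightarrow> real \<Rightarrow> complex ^ 'n \<Rightarrow> complex ^ 'n \<Rightarrow> real" where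
  "second_moment_gain k k' h v =
     (1 + k) * (cmod (herm h v))\<^sup>2 + k' * (\<Sum>i\<in>UNIV. (cmod (h $ i))\<^sup>2 * (cmod (v $ i))\<^sup>2)"

lemma cmod_one_minus_sq: "(cmod (1 - z))\<^sup>2 = 1 - 2 * Re z + (cmod z)\<^sup>2"
  unfolding cmod_power2 by (simp add: power2_eq_square algebra_simps)

text \<open>The subtracted numerator is the mean square error of a y as an estimate of the scalar
  symbol: p minus twice the real correlation term plus |a|^2 times the total received power.\<close>

lemma dl_mutual_info_ge:
  assumes k: "0 \<le> kt" "0 \<le> kr" and sg: "0 < sg" and p: "0 < p" and e: "0 < e" and v: "norm v = 1"
    and J: "prob_space J" "sets J = sets borel" "integrable J (\<lambda>u. (cmod u)\<^sup>2)" "(\<integral>u. u \<partial>J) = 0"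
      "(\<integral>u. (cmod u)\<^sup>2 \<partial>J) = I"
  shows "(ln (p / e) + 1 - (p - 2 * p * Re (a * cnj (herm h v))
        + (cmod a)\<^sup>2 * (p * second_moment_gain kr kt h v + (I + sg\<^sup>2))) / e) / ln 2
    \<le> dl_mutual_info kt kr sg h J (beam_law p v)"
proof -
  define f where "f = beam_law p v"
  note fD = beam_law[OF p v, folded f_def]
  define c where "c = herm h v"
  define N where "N = cn_diag (\<chi> i. kt * (p * (cmod (v $ i))\<^sup>2)) \<Otimes>\<^sub>M
      (cn (kr * (p * (cmod c)\<^sup>2)) \<Otimes>\<^sub>M (cn (sg\<^sup>2) \<Otimes>\<^sub>M J))"
  define W where "W = (\<lambda>(eta_t :: complex ^ 'a, eta_r :: complex, n :: complex, i :: complex). bilin h eta_t + (eta_r + (n + i)))"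
  note [measurable_cong] = J(2)
  have bilin_v: "bilin h (cvec v) = cnj c"
    by (simp add: c_def herm_def bilin_def cvec_def)
  have sq: "z * cnj z = of_real ((cmod z)\<^sup>2)" for z by (simp only: complex_norm_square)
  \<comment> \<open>The correlation matrix of the beam has rank one, which makes all distortion
    variances explicit in h and v.\<close>
  have "bilin h (corr_mat f *v cvec h) = of_real p * (bilin h (cvec v) * c)"
    by (simp add: bilin_def matrix_vector_mult_def fD(3) c_def herm_def cvec_def sum_product sum_distrib_left ac_simps)
      (rule sum.swap)
  then have b: "bilin h (corr_mat f *v cvec h) = of_real (p * (cmod c)\<^sup>2)"
    by (simp add: bilin_v sq mult.commute[of "cnj c"] del: of_real_power)
  have d: "corr_mat f $ i $ i = of_real (p * (cmod (v $ i))\<^sup>2)" for i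
    by (simp add: fD(3) mult.assoc mult.commute[of "cnj _"] sq del: of_real_power)
  have law: "dl_law kt kr sg h J f = f \<Otimes>\<^sub>M N"
    unfolding dl_law_def b d N_def by simp
  have cn: "noisy (cn (sg\<^sup>2)) (cn (sg\<^sup>2)) (\<lambda>z. z)"
    by (rule noisy_self[where v = "sg\<^sup>2"]) (use sg in \<open>auto intro: nn_integral_cn_shift\<close>)
  have cr: "centered (cn (kr * (p * (cmod c)\<^sup>2))) (\<lambda>z. z) (kr * (p * (cmod c)\<^sup>2))"
    using k p by (intro centered_cn) auto
  have ct: "centered (cn_diag (\<chi> i. kt * (p * (cmod (v $ i))\<^sup>2))) (bilin h)
      (\<Sum>i\<in>UNIV. (cmod (h $ i))\<^sup>2 * (\<chi> i. kt * (p * (cmod (v $ i))\<^sup>2)) $ i)"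
    unfolding bilin_def using k p by (intro centered_cn_diag) auto
  have idJ: "(\<lambda>z. z) \<in> borel_measurable J" by (simp add: measurable_cong_sets[OF J(2) refl])
  have cJ: "centered J (\<lambda>z. z) I" using J idJ by (simp add: centered_def)
  have W_eq: "W = (\<lambda>(x, y). bilin h x + (case y of (x, y) \<Rightarrow> x + (case y of (x, y) \<Rightarrow> x + y)))"
    by (auto simp: W_def)
  \<comment> \<open>The nesting mirrors the factors of the channel law: interference is added to the
    right of the thermal noise, the two distortions to its left.\<close>
  have noisy: "noisy (cn (sg\<^sup>2)) N W"
    unfolding N_def W_eq
    by (rule noisy_pair(1)[OF centeredD(1-3)[OF ct]
      noisy_pair(1)[OF centeredD(1-3)[OF cr] noisy_pair(2)[OF J(1) idJ J(3) cn]]])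
  define q where "q = (\<Sum>i\<in>UNIV. (cmod (h $ i))\<^sup>2 * (\<chi> i. kt * (p * (cmod (v $ i))\<^sup>2)) $ i) + (kr * (p * (cmod c)\<^sup>2) + (sg\<^sup>2 + I))"
  have cW: "centered N W q"
    unfolding N_def W_eq q_def by (rule centered_pair[OF ct centered_pair[OF cr centered_pair[OF centered_cn cJ]]]) simp
  \<comment> \<open>The error x - a y is (1 - a conj(c)) x minus a times the noise, and the two
    parts are independent.\<close>
  have "centered (cn p) (\<lambda>x. (1 - a * cnj c) * x) ((cmod (1 - a * cnj c))\<^sup>2 * p)"
    using p by (intro centered_mult centered_cn) simp
  \<comment> \<open>By the unit norm of v, \<open>bilin v\<close> inverts the beam and recovers the
    symbol from s.\<close>
  moreover have bv: "bilin v (x *s cvec v) = x" for x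
  proof -
    have "bilin v (x *s cvec v) = x * herm v v"
      by (simp add: bilin_def herm_def cvec_def sum_distrib_left algebra_simps)
    then show ?thesis by (simp add: herm_self v)
  qed
  moreover have bh: "bilin h (x *s cvec v) = x * cnj c" for x
    unfolding bilin_v[symmetric] by (simp add: bilin_def sum_distrib_left ac_simps)
  ultimately have "centered f (\<lambda>s. bilin v s - a * bilin h s) ((cmod (1 - a * cnj c))\<^sup>2 * p)"
    unfolding f_def beam_law_def by (subst centered_distr) (auto simp: algebra_simps)
  from centered_pair[OF this centered_mult[OF cW, of "- a"]]
  have err: "centered (f \<Otimes>\<^sub>M N) (\<lambda>(s, w). bilin v s - a * (bilin h s + W w))
      ((cmod (1 - a * cnj c))\<^sup>2 * p + (cmod a)\<^sup>2 * q)"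
    by (simp add: algebra_simps)
  have \<xi>_law: "distr f borel (bilin v) = cn p"
    unfolding f_def beam_law_def
    by (subst distr_distr) (auto simp: comp_def bv intro!: distr_id2[simplified])
  have "integrable f (\<lambda>s. (norm (bilin h s))\<^sup>2)"
    unfolding f_def beam_law_def using centeredD(3)[OF centered_cn[of p]] p
    by (subst integrable_distr_eq) (auto simp: bh norm_mult power_mult_distrib)
  then have "(ln (p / e) + 1 - ((cmod (1 - a * cnj c))\<^sup>2 * p + (cmod a)\<^sup>2 * q) / e) / ln 2
    \<le> prob_space.mutual_information (f \<Otimes>\<^sub>M N) 2 borel borel fst (\<lambda>(s, w). bilin h s + W w)"
    by (intro linear_estimate_mutual_information_ge[where \<xi> = "bilin v" and \<eta> = "\<lambda>y. a * y" and N = N and \<nu> = "cn (sg\<^sup>2)"]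
      fD noisy err \<xi>_law p e centeredD(3)[OF cW]) auto
  also have "\<dots> = dl_mutual_info kt kr sg h J f"
    unfolding dl_mutual_info_def law
    by (intro arg_cong2[where f = "prob_space.mutual_information (f \<Otimes>\<^sub>M N) 2 borel borel"])
      (auto simp: W_def algebra_simps)
  finally have "(ln (p / e) + 1 - ((cmod (1 - a * cnj c))\<^sup>2 * p + (cmod a)\<^sup>2 * q) / e) / ln 2
    \<le> dl_mutual_info kt kr sg h J f" .
  moreover have "q = p * (kr * (cmod c)\<^sup>2 + kt * (\<Sum>i\<in>UNIV. (cmod (h $ i))\<^sup>2 * (cmod (v $ i))\<^sup>2)) + (I + sg\<^sup>2)"
    by (simp add: q_def sum_distrib_left algebra_simps)
  then have "(cmod (1 - a * cnj c))\<^sup>2 * p + (cmod a)\<^sup>2 * q = p - 2 * p * Re (a * cnj c)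
      + (cmod a)\<^sup>2 * (p * second_moment_gain kr kt h v + (I + sg\<^sup>2))"
    unfolding cmod_one_minus_sq norm_mult power_mult_distrib complex_mod_cnj second_moment_gain_def c_def[symmetric]
    by (simp add: algebra_simps del: times_complex.sel)
  ultimately show ?thesis by (simp only: f_def c_def)
qed

section \<open>Uplink\<close>

lemma centered_herm:
  fixes J :: "(complex ^ 'n) measure"
  assumes "prob_space J" "sets J = sets borel" "integrable J (\<lambda>u. (norm u)\<^sup>2)" "(\<integral>u. u \<partial>J) = 0"
  shows "centered J (herm v) (Re (herm v (corr_mat J *v v)))"
proof -
  have "(\<Sum>i\<in>UNIV. \<Sum>j\<in>UNIV. cnj (v $ i) * cnj (cnj (v $ j)) * corr_mat J $ i $ j) = herm v (corr_mat J *v v)"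
    by (simp add: herm_def matrix_vector_mult_def sum_distrib_left ac_simps)
  then show ?thesis
    using centered_lincomb[OF assms, of "\<lambda>i. cnj (v $ i)"] unfolding herm_def by simp
qed

lemma Re_herm_add_mat:
  assumes "norm v = 1"
  shows "Re (herm v ((Q + mat (complex_of_real s)) *v v)) = Re (herm v (Q *v v)) + s"
proof -
  have "mat (complex_of_real s) *v v = complex_of_real s *s v"
    by (simp add: mat_def matrix_vector_mult_def vec_eq_iff if_distrib[of "\<lambda>x. x * _"] sum.delta cong: if_cong)
  then show ?thesis
    by (simp add: matrix_vector_mult_add_rdistrib herm_self assms)
qed

text \<open>The information is that of the whole vector z; the combiner v enters only through the
  estimate a v^H z of the symbol, so no separate step from z to v^H z is taken.\<close>

lemma ul_mutual_info_ge:
  assumes k: "0 \<le> kt" "0 \<le> kr" and sg: "0 < sg" and p: "0 < p" and e: "0 < e" and v: "norm v = 1"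
    and J: "prob_space J" "sets J = sets borel" "integrable J (\<lambda>u. (norm u)\<^sup>2)" "(\<integral>u. u \<partial>J) = 0"
      "corr_mat J = Q"
  shows "(ln (p / e) + 1 - (p - 2 * p * Re (a * cnj (herm h v))
        + (cmod a)\<^sup>2 * (p * second_moment_gain kt kr h v
            + Re (herm v ((Q + mat (complex_of_real (sg\<^sup>2))) *v v)))) / e) / ln 2
    \<le> ul_mutual_info kt kr sg p h J (cn p)"
proof -
  define c where "c = herm h v"
  have vh: "herm v h = cnj c" by (simp add: c_def cnj_herm)
  define L where "L = ul_noise_law kt kr sg p h"
  define N where "N = L \<Otimes>\<^sub>M J"
  define W where "W = (\<lambda>((eta_t, eta_r, n), i). eta_t *s h + (eta_r + n) + i)"
  note [measurable_cong] = J(2)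
  have idJ: "(\<lambda>z. z) \<in> borel_measurable J" by (simp add: measurable_cong_sets[OF J(2) refl])
  have L: "L = cn (kt * p) \<Otimes>\<^sub>M (cn_diag (\<chi> i. kr * p * (cmod (h $ i))\<^sup>2) \<Otimes>\<^sub>M cn_diag (\<chi> i. sg\<^sup>2))"
    by (simp add: L_def ul_noise_law_def)
  have cn: "noisy (cn_diag (\<chi> i. sg\<^sup>2)) (cn_diag (\<chi> i. sg\<^sup>2)) (\<lambda>z :: complex ^ 'a. z)"
    by (rule noisy_self[where v = "sg\<^sup>2"]) (use sg in \<open>auto intro: nn_integral_cn_diag_shift\<close>)
  have ct: "centered (cn (kt * p)) (\<lambda>z. z) (kt * p)"
    using k p by (intro centered_cn) auto
  have cr: "centered (cn_diag (\<chi> i. kr * p * (cmod (h $ i))\<^sup>2)) (herm v)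
      (\<Sum>i\<in>UNIV. (cmod (cnj (v $ i)))\<^sup>2 * (\<chi> i. kr * p * (cmod (h $ i))\<^sup>2) $ i)"
    unfolding herm_def using k p by (intro centered_cn_diag) auto
  have cs: "centered (cn_diag (\<chi> i. sg\<^sup>2)) (herm v)
      (\<Sum>i\<in>UNIV. (cmod (cnj (v $ i)))\<^sup>2 * (\<chi> i. sg\<^sup>2) $ i)"
    unfolding herm_def by (intro centered_cn_diag) auto
  have cJ: "centered J (herm v) (Re (herm v (Q *v v)))"
    using centered_herm[OF J(1-4)] by (simp add: J(5))
  have W_eq: "W = (\<lambda>(x, i). (case x of (t, y) \<Rightarrow> t *s h + (case y of (r, n) \<Rightarrow> r + n)) + i)"
    by (auto simp: W_def)
  have sq_r: "integrable (cn_diag (\<chi> i. kr * p * (cmod (h $ i))\<^sup>2)) (\<lambda>z. (norm z)\<^sup>2)"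
    using k p by (intro integrable_cn_diag_sq) auto
  have sq_n: "integrable (cn_diag (\<chi> i :: 'a. sg\<^sup>2)) (\<lambda>z. (norm z)\<^sup>2)"
    by (intro integrable_cn_diag_sq) auto
  have sq_t: "integrable (cn (kt * p)) (\<lambda>z. (norm (z *s h))\<^sup>2)"
    using centeredD(3)[OF ct] by (simp add: norm_vector_scale power_mult_distrib)
  have noisy: "noisy (cn_diag (\<chi> i. sg\<^sup>2)) N W"
    unfolding N_def L W_eq
    by (rule noisy_pair(2)[OF J(1) idJ J(3) noisy_pair(1)[OF _ _ sq_t noisy_pair(1)[OF _ _ sq_r cn]]])
      simp_all
  \<comment> \<open>The density bounds involve the norm of the whole output vector, so the second
    moment of \<open>W\<close> itself is required besides that of its combined version.\<close>
  have iW: "integrable N (\<lambda>w. (norm (W w))\<^sup>2)"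
  proof -
    have 1: "integrable (cn_diag (\<chi> i. kr * p * (cmod (h $ i))\<^sup>2) \<Otimes>\<^sub>M cn_diag (\<chi> i :: 'a. sg\<^sup>2))
        (\<lambda>y. (norm (case y of (r, n) \<Rightarrow> r + n))\<^sup>2)"
      unfolding split_beta'
      by (rule integrable_pair_norm_add_sq[OF _ _ _ sq_r _ sq_n, unfolded split_beta']) simp_all
    have 2: "integrable L (\<lambda>x. (norm (case x of (t, y) \<Rightarrow> t *s h + (case y of (r, n) \<Rightarrow> r + n)))\<^sup>2)"
      unfolding L
      using integrable_pair_norm_add_sq[OF prob_space_cn prob_space_pair[OF prob_space_cn_diag prob_space_cn_diag]
        measurable_scale_cn sq_t _ 1]
      by (simp add: split_beta')
    have pL: "prob_space L" unfolding L by (intro prob_space_pair prob_space_cn prob_space_cn_diag)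
    have mL: "(\<lambda>x. case x of (t, y) \<Rightarrow> t *s h + (case y of (r, n) \<Rightarrow> r + n)) \<in> borel_measurable L"
      unfolding L split_beta' by (intro borel_measurable_add borel_measurable_vector_scale) measurable
    show ?thesis
      using integrable_pair_norm_add_sq[OF pL J(1) mL 2 idJ J(3)] unfolding N_def W_eq
      by (simp add: split_beta')
  qed
  define q where "q = ((cmod (cnj c))\<^sup>2 * (kt * p) + ((\<Sum>i\<in>UNIV. (cmod (cnj (v $ i)))\<^sup>2 * (\<chi> i. kr * p * (cmod (h $ i))\<^sup>2) $ i)
    + (\<Sum>i\<in>UNIV. (cmod (cnj (v $ i)))\<^sup>2 * (\<chi> i. sg\<^sup>2) $ i)))
    + Re (herm v (Q *v v))"
  have "centered N (\<lambda>(x, i). (case x of (t, y) \<Rightarrow> cnj c * t + (case y of (r, n) \<Rightarrow> herm v r + herm v n)) + herm v i) q"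
    unfolding N_def L q_def by (rule centered_pair[OF centered_pair[OF centered_mult[OF ct] centered_pair[OF cr cs]] cJ])
  also have "(\<lambda>(x, i). (case x of (t, y) \<Rightarrow> cnj c * t + (case y of (r, n) \<Rightarrow> herm v r + herm v n)) + herm v i)
     = (\<lambda>w. herm v (W w))"
    by (auto simp: W_def vh)
  finally have cW: "centered N (\<lambda>w. herm v (W w)) q" .
  have "centered (cn p) (\<lambda>x. (1 - a * cnj c) * x) ((cmod (1 - a * cnj c))\<^sup>2 * p)"
    using p by (intro centered_mult centered_cn) simp
  from centered_pair[OF this centered_mult[OF cW, of "- a"]]
  have err: "centered (cn p \<Otimes>\<^sub>M N) (\<lambda>(x, w). x - a * herm v (x *s h + W w))
      ((cmod (1 - a * cnj c))\<^sup>2 * p + (cmod a)\<^sup>2 * q)"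
    by (simp add: algebra_simps vh)
  have \<xi>_law: "distr (cn p) borel (\<lambda>z. z) = cn p"
    by (rule distr_id2) simp
  have "integrable (cn p) (\<lambda>x. (norm (x *s h))\<^sup>2)"
    using centeredD(3)[OF centered_cn[of p]] p by (simp add: norm_vector_scale power_mult_distrib)
  then have "(ln (p / e) + 1 - ((cmod (1 - a * cnj c))\<^sup>2 * p + (cmod a)\<^sup>2 * q) / e) / ln 2
    \<le> prob_space.mutual_information (cn p \<Otimes>\<^sub>M N) 2 borel borel fst (\<lambda>(x, w). x *s h + W w)"
    by (intro linear_estimate_mutual_information_ge[where \<xi> = "\<lambda>z. z" and \<eta> = "\<lambda>y. a * herm v y" and N = N and \<nu> = "cn_diag (\<chi> i. sg\<^sup>2)"]
      noisy err \<xi>_law p e iW) auto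
  also have "\<dots> = ul_mutual_info kt kr sg p h J (cn p)"
    unfolding ul_mutual_info_def N_def L_def[symmetric]
    by (intro arg_cong2[where f = "prob_space.mutual_information (cn p \<Otimes>\<^sub>M (L \<Otimes>\<^sub>M J)) 2 borel borel"])
      (auto simp: W_def ul_signal_def algebra_simps vector_sadd_rdistrib)
  finally have "(ln (p / e) + 1 - ((cmod (1 - a * cnj c))\<^sup>2 * p + (cmod a)\<^sup>2 * q) / e) / ln 2
    \<le> ul_mutual_info kt kr sg p h J (cn p)" .
  moreover have "q = p * (kt * (cmod c)\<^sup>2 + kr * (\<Sum>i\<in>UNIV. (cmod (h $ i))\<^sup>2 * (cmod (v $ i))\<^sup>2))
    + Re (herm v ((Q + mat (complex_of_real (sg\<^sup>2))) *v v))"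
  proof -
    have 1: "(\<Sum>i\<in>UNIV. (cmod (v $ i))\<^sup>2 * sg\<^sup>2) = sg\<^sup>2"
      using v unfolding sum_distrib_right[symmetric] norm_vec_sq[symmetric] by simp
    have "q = (cmod c)\<^sup>2 * (kt * p) + ((\<Sum>i\<in>UNIV. (cmod (v $ i))\<^sup>2 * (kr * p * (cmod (h $ i))\<^sup>2)) + sg\<^sup>2)
        + Re (herm v (Q *v v))"
      by (simp only: q_def complex_mod_cnj complex_cnj_cnj vec_lambda_beta 1)
    then show ?thesis
      unfolding Re_herm_add_mat[OF v] by (simp add: sum_distrib_left algebra_simps)
  qed
  then have "(cmod (1 - a * cnj c))\<^sup>2 * p + (cmod a)\<^sup>2 * q = p - 2 * p * Re (a * cnj c)
      + (cmod a)\<^sup>2 * (p * second_moment_gain kt kr h v + Re (herm v ((Q + mat (complex_of_real (sg\<^sup>2))) *v v)))"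
    unfolding cmod_one_minus_sq norm_mult power_mult_distrib complex_mod_cnj second_moment_gain_def c_def[symmetric]
    by (simp add: algebra_simps del: times_complex.sel)
  ultimately show ?thesis by (simp only: c_def)
qed

subsection \<open>Averaging over the channel state information\<close>

text \<open>In the notation of the proof, \<open>a\<close> and \<open>e\<close> are the coefficient and the mean square error of the
  linear MMSE estimate for the conditional moments \<open>X + i Y\<close> of the channel and \<open>V\<close> of the received
  power. After simplification the coefficients of the resulting bound are dominated by integrable
  functions although \<open>a\<close> and \<open>1 / e\<close> themselves are not bounded.\<close>

lemma conditional_rate_le:
  fixes c :: "'w \<Rightarrow> complex" and info :: "'w \<Rightarrow> real"
  assumes M: "prob_space M" "subalgebra M F"
    and c[measurable]: "c \<in> borel_measurable M" and ic: "integrable M (\<lambda>w. (cmod (c w))\<^sup>2)"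
    and iV: "integrable M Vw"
    and p: "0 < p" and s2: "0 < s2"
    and Vw: "\<And>w. w \<in> space M \<Longrightarrow> p * (cmod (c w))\<^sup>2 + s2 \<le> Vw w"
    and info: "\<And>w a e. w \<in> space M \<Longrightarrow> 0 < e \<Longrightarrow>
      (ln (p / e) + 1 - (p - 2 * p * Re (a * cnj (c w)) + (cmod a)\<^sup>2 * Vw w) / e) / ln 2 \<le> info w"
    and sinr: "AE w in M. sinr w = (cmod (complex_cond_exp M F c w))\<^sup>2
      / (real_cond_exp M F Vw w / p - (cmod (complex_cond_exp M F c w))\<^sup>2)"
  shows "(\<integral>\<^sup>+w. ennreal (log 2 (1 + sinr w)) \<partial>M) \<le> (\<integral>\<^sup>+w. ennreal (info w) \<partial>M)"
proof -
  interpret prob_space M by fact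
  interpret finite_measure_subalgebra M F by unfold_locales (fact M(2))
  define V where "V = real_cond_exp M F Vw"
  define X where "X = real_cond_exp M F (\<lambda>w. Re (c w))"
  define Y where "Y = real_cond_exp M F (\<lambda>w. Im (c w))"
  \<comment> \<open>\<open>n\<close> is the squared modulus of the conditional mean of c,
    \<open>D\<close> the SINR denominator and \<open>s\<close> the SINR. With the MMSE values of a
    and e chosen below, \<open>\<beta>\<close> is |a|^2 / e after cancellation.\<close>
  define n where "n w = (X w)\<^sup>2 + (Y w)\<^sup>2" for w
  define D where "D w = V w / p - n w" for w
  define s where "s w = n w / D w" for w
  define \<beta> where "\<beta> w = n w / (V w * D w)" for w
  have [measurable]: "V \<in> borel_measurable F" "X \<in> borel_measurable F" "Y \<in> borel_measurable F"
    "V \<in> borel_measurable M" "X \<in> borel_measurable M" "Y \<in> borel_measurable M"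
    unfolding V_def X_def Y_def by measurable
  have [measurable]: "Vw \<in> borel_measurable M" using iV by simp
  have n: "(cmod (complex_cond_exp M F c w))\<^sup>2 = n w" for w
    by (simp add: complex_cond_exp_def cmod_power2 n_def X_def Y_def)
  have iRe2: "integrable M (\<lambda>w. (Re (c w))\<^sup>2)" and iIm2: "integrable M (\<lambda>w. (Im (c w))\<^sup>2)"
    by (rule Bochner_Integration.integrable_bound[OF ic]; simp add: cmod_power2)+
  have iRe: "integrable M (\<lambda>w. Re (c w))" and iIm: "integrable M (\<lambda>w. Im (c w))"
    by (rule integrable_of_square_norm; simp add: iRe2 iIm2)+
  have conv: "convex_on UNIV (\<lambda>x :: real. x\<^sup>2)" by (rule convex_power2)
  \<comment> \<open>Conditional Jensen for real and imaginary parts bounds \<open>n\<close> by the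
    conditional second moment of c. With the margin \<open>s2\<close> in \<open>Vw\<close> this
    gives p n + s2 \<le> V, hence \<open>D\<close> \<ge> s2 / p, on which all integrability bounds
    below rest.\<close>
  have "AE w in M. (X w)\<^sup>2 \<le> real_cond_exp M F (\<lambda>w. (Re (c w))\<^sup>2) w"
    unfolding X_def by (rule real_cond_exp_jensens_inequality(2)[OF iRe _ _ iRe2 conv]) auto
  moreover have "AE w in M. (Y w)\<^sup>2 \<le> real_cond_exp M F (\<lambda>w. (Im (c w))\<^sup>2) w"
    unfolding Y_def by (rule real_cond_exp_jensens_inequality(2)[OF iIm _ _ iIm2 conv]) auto
  moreover have "AE w in M. real_cond_exp M F (\<lambda>w. (Re (c w))\<^sup>2 + (Im (c w))\<^sup>2) w
      = real_cond_exp M F (\<lambda>w. (Re (c w))\<^sup>2) w + real_cond_exp M F (\<lambda>w. (Im (c w))\<^sup>2) w"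
    by (rule real_cond_exp_add[OF iRe2 iIm2])
  moreover have "AE w in M. real_cond_exp M F (\<lambda>w. p * ((Re (c w))\<^sup>2 + (Im (c w))\<^sup>2)) w
      = p * real_cond_exp M F (\<lambda>w. (Re (c w))\<^sup>2 + (Im (c w))\<^sup>2) w"
    using iRe2 iIm2 by (intro real_cond_exp_cmult) auto
  moreover have "AE w in M. real_cond_exp M F (\<lambda>w. p * ((Re (c w))\<^sup>2 + (Im (c w))\<^sup>2)) w
      \<le> real_cond_exp M F (\<lambda>w. Vw w - s2) w"
    using iRe2 iIm2 iV Vw by (intro real_cond_exp_mono) (auto simp: cmod_power2 le_diff_eq)
  moreover have "AE w in M. real_cond_exp M F (\<lambda>w. Vw w - s2) w = V w - real_cond_exp M F (\<lambda>w. s2) w"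
    unfolding V_def using iV by (intro real_cond_exp_diff) auto
  moreover have "AE w in M. real_cond_exp M F (\<lambda>w. s2) w = s2"
    by (intro real_cond_exp_F_meas) auto
  ultimately have "AE w in M. p * n w + s2 \<le> V w"
  proof eventually_elim
    case (elim w)
    have "p * n w \<le> p * (real_cond_exp M F (\<lambda>w. (Re (c w))\<^sup>2) w + real_cond_exp M F (\<lambda>w. (Im (c w))\<^sup>2) w)"
      using p elim(1,2) unfolding n_def by (intro mult_left_mono) auto
    then show ?case using elim by simp
  qed
  then have good: "AE w in M. p * n w \<le> V w \<and> 0 < V w \<and> s2 / p \<le> D w \<and> 0 < D w"
  proof eventually_elim
    case (elim w)
    have "0 \<le> p * n w" using p by (simp add: n_def)
    then have "p * n w \<le> V w" "0 < V w" using elim s2 by auto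
    moreover have "s2 / p \<le> D w" unfolding D_def using elim p by (simp add: field_simps)
    moreover have "0 < s2 / p" using p s2 by simp
    ultimately show ?case by auto
  qed
  have [measurable]: "n \<in> borel_measurable F" "D \<in> borel_measurable F" "s \<in> borel_measurable F" "\<beta> \<in> borel_measurable F"
    unfolding n_def D_def s_def \<beta>_def by measurable
  have [measurable]: "n \<in> borel_measurable M" "D \<in> borel_measurable M" "s \<in> borel_measurable M" "\<beta> \<in> borel_measurable M"
    unfolding n_def D_def s_def \<beta>_def by measurable
  have n0: "0 \<le> n w" for w by (simp add: n_def)
  have iVc: "integrable M V" unfolding V_def using iV by (rule real_cond_exp_int)
  have in': "integrable M n"
  proof (rule Bochner_Integration.integrable_bound[of _ "\<lambda>w. V w / p"])
    show "AE w in M. norm (n w) \<le> norm (V w / p)"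
      using good by eventually_elim (use p n0 in \<open>auto simp: field_simps\<close>)
  qed (use iVc in auto)
  have s_bound: "AE w in M. 0 \<le> s w \<and> s w \<le> n w * (p / s2)"
    using good
  proof eventually_elim
    case (elim w)
    have "n w / D w \<le> n w / (s2 / p)"
      using elim n0 p s2 by (intro divide_left_mono) auto
    then show ?case using elim n0[of w] by (auto simp: s_def)
  qed
  have i_s: "integrable M s"
  proof (rule Bochner_Integration.integrable_bound[of _ "\<lambda>w. n w * (p / s2)"])
    show "AE w in M. norm (s w) \<le> norm (n w * (p / s2))"
      using s_bound by eventually_elim (use n0 p s2 in \<open>auto simp: abs_mult\<close>)
  qed (use in' in auto)
  have iln: "integrable M (\<lambda>w. ln (1 + s w))"
  proof (rule Bochner_Integration.integrable_bound[OF i_s])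
    show "AE w in M. norm (ln (1 + s w)) \<le> norm (s w)"
      using s_bound by eventually_elim (auto simp: ln_add_one_self_le_self)
  qed simp
  \<comment> \<open>Neither factor is bounded, but both are square integrable: the
    arithmetic-geometric mean inequality and the lower bound on \<open>D\<close> give an integrable
    majorant.\<close>
  have i\<alpha>: "integrable M (\<lambda>w. Z w / D w * z (c w))"
    if [measurable]: "Z \<in> borel_measurable M" "(\<lambda>w. z (c w)) \<in> borel_measurable M"
      and Z: "\<And>w. (Z w)\<^sup>2 \<le> n w" and z: "\<And>x. (z x)\<^sup>2 \<le> (cmod x)\<^sup>2" for Z z
  proof (rule Bochner_Integration.integrable_bound[of _ "\<lambda>w. (n w + (cmod (c w))\<^sup>2) * (p / s2)"])
    show "AE w in M. norm (Z w / D w * z (c w)) \<le> norm ((n w + (cmod (c w))\<^sup>2) * (p / s2))"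
      using good
    proof eventually_elim
      case (elim w)
      have "2 * (\<bar>Z w\<bar> * \<bar>z (c w)\<bar>) \<le> (Z w)\<^sup>2 + (z (c w))\<^sup>2"
        using zero_le_power2[of "\<bar>Z w\<bar> - \<bar>z (c w)\<bar>"] by (simp add: power2_diff)
      then have "\<bar>Z w\<bar> * \<bar>z (c w)\<bar> \<le> n w + (cmod (c w))\<^sup>2"
        using Z[of w] z[of "c w"] by (smt (verit) mult_nonneg_nonneg abs_ge_zero)
      then have "\<bar>Z w\<bar> * \<bar>z (c w)\<bar> / D w \<le> (n w + (cmod (c w))\<^sup>2) / (s2 / p)"
        using elim p s2 n0[of w] by (intro frac_le) auto
      then show ?case using elim(1) n0[of w] p s2 by (simp add: abs_mult)
    qed
  qed (use in' ic in auto)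
  have iX: "integrable M (\<lambda>w. X w / D w * Re (c w))" and iY: "integrable M (\<lambda>w. Y w / D w * Im (c w))"
    by (rule i\<alpha>; simp add: n_def cmod_power2)+
  \<comment> \<open>From n \<le> V / p and D \<ge> s2 / p, the unbounded V cancels and \<beta> \<le>
    1 / s2.\<close>
  have i\<beta>: "integrable M (\<lambda>w. \<beta> w * Vw w)"
  proof (rule Bochner_Integration.integrable_bound[of _ "\<lambda>w. (1 / s2) * Vw w"])
    show "AE w in M. norm (\<beta> w * Vw w) \<le> norm ((1 / s2) * Vw w)"
      using good
    proof eventually_elim
      case (elim w)
      have "n w / (V w * D w) \<le> (V w / p) / (V w * (s2 / p))"
        using elim n0[of w] p s2 by (intro frac_le mult_left_mono) (auto simp: field_simps)
      then have "\<beta> w \<le> 1 / s2" using elim p s2 by (simp add: \<beta>_def)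
      moreover have "0 \<le> \<beta> w" using elim n0[of w] by (simp add: \<beta>_def)
      ultimately show ?case using s2 unfolding real_norm_def abs_mult by (intro mult_right_mono) auto
    qed
  qed (use iV in auto)
  \<comment> \<open>The coefficients are measurable with respect to F, so under the integral Re c,
    Im c and \<open>Vw\<close> may be exchanged with their conditional expectations.\<close>
  note EX = real_cond_exp_intg[OF iX, folded X_def] and EY = real_cond_exp_intg[OF iY, folded Y_def]
    and E\<beta> = real_cond_exp_intg[OF i\<beta>, folded V_def]
  have EX': "integrable M (\<lambda>w. X w / D w * X w)" "(\<integral>w. X w / D w * X w \<partial>M) = (\<integral>w. X w / D w * Re (c w) \<partial>M)"
    and EY': "integrable M (\<lambda>w. Y w / D w * Y w)" "(\<integral>w. Y w / D w * Y w \<partial>M) = (\<integral>w. Y w / D w * Im (c w) \<partial>M)"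
    and E\<beta>': "integrable M (\<lambda>w. \<beta> w * V w)" "(\<integral>w. \<beta> w * V w \<partial>M) = (\<integral>w. \<beta> w * Vw w \<partial>M)"
    by (rule EX EY E\<beta>; measurable)+
  define L where "L w = ln (1 + s w) - s w + 2 * (X w / D w * Re (c w) + Y w / D w * Im (c w)) - \<beta> w * Vw w" for w
  have lin: "integrable M (\<lambda>w. f1 w - f2 w + 2 * (f3 w + f4 w) - f5 w)"
    "(\<integral>w. f1 w - f2 w + 2 * (f3 w + f4 w) - f5 w \<partial>M)
      = (\<integral>w. f1 w \<partial>M) - (\<integral>w. f2 w \<partial>M) + 2 * ((\<integral>w. f3 w \<partial>M) + (\<integral>w. f4 w \<partial>M)) - (\<integral>w. f5 w \<partial>M)"
    if "integrable M f1" "integrable M f2" "integrable M f3" "integrable M f4" "integrable M f5"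
    for f1 f2 f3 f4 f5 :: "'w \<Rightarrow> real"
    using that by simp_all
  have iL: "integrable M L" unfolding L_def by (rule lin(1)[OF iln i_s iX iY i\<beta>])
  have "(\<integral>w. L w \<partial>M) = (\<integral>w. ln (1 + s w) - s w + 2 * (X w / D w * X w + Y w / D w * Y w) - \<beta> w * V w \<partial>M)"
    unfolding L_def lin(2)[OF iln i_s iX iY i\<beta>] lin(2)[OF iln i_s EX'(1) EY'(1) E\<beta>'(1)] EX'(2) EY'(2) E\<beta>'(2) ..
  also have "\<dots> = (\<integral>w. ln (1 + s w) \<partial>M)"
  proof (rule integral_cong_AE)
    show "AE w in M. ln (1 + s w) - s w + 2 * (X w / D w * X w + Y w / D w * Y w) - \<beta> w * V w = ln (1 + s w)"
      using good
    proof eventually_elim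
      case (elim w)
      have "X w / D w * X w + Y w / D w * Y w = s w"
        by (simp add: s_def n_def power2_eq_square add_divide_distrib)
      moreover have "\<beta> w * V w = s w" using elim by (simp add: \<beta>_def s_def)
      ultimately show ?case by simp
    qed
  qed measurable
  finally have EL: "(\<integral>w. L w \<partial>M) = (\<integral>w. ln (1 + s w) \<partial>M)" .
  have L_info: "AE w in M. L w / ln 2 \<le> info w"
    using good AE_space
  proof eventually_elim
    case (elim w)
    \<comment> \<open>The MMSE coefficient p E(c | F) / V and its error p - p^2 n / V, which equals
      p^2 D / V.\<close>
    define a where "a = complex_of_real (p / V w) * Complex (X w) (Y w)"
    define e where "e = p\<^sup>2 * D w / V w"
    have e: "0 < e" using elim p by (simp add: e_def)
    have a2: "(cmod a)\<^sup>2 = (p / V w)\<^sup>2 * n w"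
      unfolding a_def norm_mult power_mult_distrib by (simp add: cmod_power2 n_def)
    have pe: "p / e = 1 + s w"
    proof -
      have "p / e = V w / (p * D w)" using p by (simp add: e_def power2_eq_square)
      also have "V w = p * (D w + n w)" using p by (simp add: D_def field_simps)
      also have "p * (D w + n w) / (p * D w) = 1 + s w" using p elim by (simp add: s_def field_simps)
      finally show ?thesis .
    qed
    have 1: "p * Re (a * cnj (c w)) / e = X w / D w * Re (c w) + Y w / D w * Im (c w)"
    proof -
      have r: "Re (a * cnj (c w)) = p / V w * (X w * Re (c w) + Y w * Im (c w))"
        by (simp add: a_def algebra_simps add_divide_distrib)
      have "p * Re (a * cnj (c w)) / e = (X w * Re (c w) + Y w * Im (c w)) / D w"
        unfolding r e_def using p elim by (simp add: power2_eq_square)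
      then show ?thesis by (simp add: add_divide_distrib)
    qed
    have 2: "(cmod a)\<^sup>2 * Vw w / e = \<beta> w * Vw w"
      unfolding a2 e_def \<beta>_def using p elim by (simp add: field_simps power2_eq_square)
    have "L w = ln (p / e) + 1 - (p - 2 * p * Re (a * cnj (c w)) + (cmod a)\<^sup>2 * Vw w) / e"
    proof -
      have "(p - 2 * p * Re (a * cnj (c w)) + (cmod a)\<^sup>2 * Vw w) / e
        = p / e - 2 * (p * Re (a * cnj (c w)) / e) + (cmod a)\<^sup>2 * Vw w / e"
        by (simp only: add_divide_distrib diff_divide_distrib)
      then show ?thesis unfolding pe 1 2 L_def by simp
    qed
    then show ?case using info[OF elim(2) e, of a] by simp
  qed
  have "(\<integral>\<^sup>+w. ennreal (log 2 (1 + sinr w)) \<partial>M) = (\<integral>\<^sup>+w. ennreal (ln (1 + s w) / ln 2) \<partial>M)"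
  proof (rule nn_integral_cong_AE)
    show "AE w in M. ennreal (log 2 (1 + sinr w)) = ennreal (ln (1 + s w) / ln 2)"
      using sinr by eventually_elim (simp add: n s_def D_def V_def log_def)
  qed
  also have "\<dots> = ennreal (\<integral>w. ln (1 + s w) / ln 2 \<partial>M)"
  proof (rule nn_integral_eq_integral)
    show "AE w in M. 0 \<le> ln (1 + s w) / ln 2"
      using s_bound by eventually_elim simp
  qed (use iln in simp)
  also have "\<dots> = ennreal (\<integral>w. L w / ln 2 \<partial>M)" using EL by simp
  \<comment> \<open>\<open>L\<close> may be negative at some realizations; \<open>ennreal\<close>
    truncates there, which only raises the right-hand integral.\<close>
  also have "\<dots> \<le> (\<integral>\<^sup>+w. ennreal (L w / ln 2) \<partial>M)"
  proof -
    have "ennreal (\<integral>w. L w / ln 2 \<partial>M) \<le> ennreal (\<integral>w. max 0 (L w / ln 2) \<partial>M)"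
      using iL by (intro ennreal_leI integral_mono) auto
    also have "\<dots> = (\<integral>\<^sup>+w. ennreal (max 0 (L w / ln 2)) \<partial>M)"
      using iL by (intro nn_integral_eq_integral[symmetric]) auto
    also have "\<dots> = (\<integral>\<^sup>+w. ennreal (L w / ln 2) \<partial>M)"
      by (intro nn_integral_cong) (auto simp: max_def ennreal_neg)
    finally show ?thesis .
  qed
  also have "\<dots> \<le> (\<integral>\<^sup>+w. ennreal (info w) \<partial>M)"
  proof (rule nn_integral_mono_AE)
    show "AE w in M. ennreal (L w / ln 2) \<le> ennreal (info w)"
      using L_info by eventually_elim (rule ennreal_leI)
  qed
  finally show ?thesis .
qed

text \<open>Bounding every coordinate by the norm costs a dimension factor compared with
  Cauchy-Schwarz, harmless because the estimate only serves integrability.\<close>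

lemma cmod_herm_le:
  fixes x y :: "complex ^ 'n"
  assumes "norm y = 1"
  shows "(cmod (herm x y))\<^sup>2 \<le> (real CARD('n))\<^sup>2 * (norm x)\<^sup>2"
proof -
  have "cmod (herm x y) \<le> (\<Sum>i\<in>(UNIV :: 'n set). norm x * norm y)"
    unfolding herm_def
    by (rule order_trans[OF norm_sum sum_mono]) (auto simp: norm_mult intro!: mult_mono Finite_Cartesian_Product.norm_nth_le)
  then have "cmod (herm x y) \<le> real CARD('n) * norm x" using assms by simp
  then have "(cmod (herm x y))\<^sup>2 \<le> (real CARD('n) * norm x)\<^sup>2" by (intro power_mono) auto
  then show ?thesis by (simp add: power_mult_distrib)
qed

text \<open>The form common to both links, with N the power of interference and thermal noise after
  combining and \<sigma> its guaranteed noise part. Linearity of conditional expectation, valid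
  almost everywhere, splits the received power into the terms of the SINR denominator.\<close>

lemma csi_rate_le:
  fixes h v :: "'w \<Rightarrow> complex ^ 'n" and info :: "'w \<Rightarrow> real"
  assumes M: "prob_space M" "subalgebra M F"
    and h[measurable]: "h \<in> borel_measurable M" and ih: "integrable M (\<lambda>w. (norm (h w))\<^sup>2)"
    and v[measurable]: "v \<in> borel_measurable M" and v1: "\<And>w. norm (v w) = 1"
    and N: "integrable M N" and \<sigma>: "0 < \<sigma>" "\<And>w. w \<in> space M \<Longrightarrow> \<sigma> \<le> N w"
    and p: "0 < p" and k: "0 \<le> k" "0 \<le> k'"
    and info: "\<And>w a e. w \<in> space M \<Longrightarrow> 0 < e \<Longrightarrow>
      (ln (p / e) + 1 - (p - 2 * p * Re (a * cnj (herm (h w) (v w)))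
        + (cmod a)\<^sup>2 * (p * second_moment_gain k k' (h w) (v w) + N w)) / e) / ln 2 \<le> info w"
    and sinr: "AE w in M. sinr w = (cmod (complex_cond_exp M F (\<lambda>w. herm (h w) (v w)) w))\<^sup>2 /
     ((1 + k) * real_cond_exp M F (\<lambda>w. (cmod (herm (h w) (v w)))\<^sup>2) w
       - (cmod (complex_cond_exp M F (\<lambda>w. herm (h w) (v w)) w))\<^sup>2
       + k' * (\<Sum>i\<in>UNIV. real_cond_exp M F (\<lambda>w. (cmod (h w $ i))\<^sup>2 * (cmod (v w $ i))\<^sup>2) w)
       + real_cond_exp M F N w / p)"
  shows "(\<integral>\<^sup>+w. ennreal (log 2 (1 + sinr w)) \<partial>M) \<le> (\<integral>\<^sup>+w. ennreal (info w) \<partial>M)"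
proof -
  interpret prob_space M by fact
  interpret finite_measure_subalgebra M F by unfold_locales (fact M(2))
  define A where "A w = (cmod (herm (h w) (v w)))\<^sup>2" for w
  define B where "B i w = (cmod (h w $ i))\<^sup>2 * (cmod (v w $ i))\<^sup>2" for i w
  have iA: "integrable M A"
  proof (rule Bochner_Integration.integrable_bound)
    show "integrable M (\<lambda>w. (real CARD('n))\<^sup>2 * (norm (h w))\<^sup>2)" using ih by simp
  qed (auto simp: A_def[abs_def] intro!: cmod_herm_le v1)
  have iB: "integrable M (B i)" for i
  proof (rule Bochner_Integration.integrable_bound[OF ih])
    have "(\<lambda>w. h w $ i) \<in> borel_measurable M" "(\<lambda>w. v w $ i) \<in> borel_measurable M"
      using h v by (simp_all add: borel_measurable_vec_nth)
    note [measurable] = this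
    show "B i \<in> borel_measurable M" unfolding B_def by measurable
    have "B i w \<le> (norm (h w))\<^sup>2 * 1\<^sup>2" for w
      unfolding B_def
      by (intro mult_mono power_mono) (auto simp: v1[of w, symmetric] Finite_Cartesian_Product.norm_nth_le)
    then show "AE w in M. norm (B i w) \<le> norm ((norm (h w))\<^sup>2)" by (simp add: B_def)
  qed
  have iBs: "integrable M (\<lambda>w. \<Sum>i\<in>UNIV. B i w)" using iB by simp
  have Vw: "p * second_moment_gain k k' (h w) (v w) + N w = p * ((1 + k) * A w + k' * (\<Sum>i\<in>UNIV. B i w)) + N w" for w
    by (simp add: second_moment_gain_def A_def B_def)
  have i1: "integrable M (\<lambda>w. (1 + k) * A w)" and i2: "integrable M (\<lambda>w. k' * (\<Sum>i\<in>UNIV. B i w))"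
    using iA iBs by simp_all
  have i3: "integrable M (\<lambda>w. (1 + k) * A w + k' * (\<Sum>i\<in>UNIV. B i w))" using i1 i2 by (rule Bochner_Integration.integrable_add)
  have i4: "integrable M (\<lambda>w. p * ((1 + k) * A w + k' * (\<Sum>i\<in>UNIV. B i w)))" using i3 by (rule integrable_mult_right)
  show ?thesis
  proof (rule conditional_rate_le[OF M _ _ _ p \<sigma>(1) _ info])
    show "integrable M (\<lambda>w. (cmod (herm (h w) (v w)))\<^sup>2)" using iA by (simp add: A_def[abs_def])
    show "integrable M (\<lambda>w. p * second_moment_gain k k' (h w) (v w) + N w)"
      unfolding Vw using i4 N by (rule Bochner_Integration.integrable_add)
    fix w assume w: "w \<in> space M"
    have "0 \<le> k * A w" "0 \<le> k' * (\<Sum>i\<in>UNIV. B i w)"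
      using k by (auto simp: A_def B_def intro!: mult_nonneg_nonneg sum_nonneg)
    then have "A w \<le> (1 + k) * A w + k' * (\<Sum>i\<in>UNIV. B i w)"
      by (simp add: algebra_simps)
    then have "p * A w \<le> p * ((1 + k) * A w + k' * (\<Sum>i\<in>UNIV. B i w))"
      using p by (intro mult_left_mono) auto
    then show "p * (cmod (herm (h w) (v w)))\<^sup>2 + \<sigma> \<le> p * second_moment_gain k k' (h w) (v w) + N w"
      unfolding Vw using \<sigma>(2)[OF w] by (simp add: A_def)
  next
    show "AE w in M. sinr w = (cmod (complex_cond_exp M F (\<lambda>w. herm (h w) (v w)) w))\<^sup>2 /
      (real_cond_exp M F (\<lambda>w. p * second_moment_gain k k' (h w) (v w) + N w) w / p
        - (cmod (complex_cond_exp M F (\<lambda>w. herm (h w) (v w)) w))\<^sup>2)"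
      unfolding Vw
      using sinr real_cond_exp_add[OF i4 N] real_cond_exp_cmult[OF i3, of p] real_cond_exp_add[OF i1 i2]
        real_cond_exp_cmult[OF iA, of "1 + k"] real_cond_exp_cmult[OF iBs, of k'] real_cond_exp_sum[where f = B and I = UNIV, OF iB]
    proof eventually_elim
      case (elim w)
      have "real_cond_exp M F (\<lambda>w. p * ((1 + k) * A w + k' * (\<Sum>i\<in>UNIV. B i w)) + N w) w / p
        = (1 + k) * real_cond_exp M F A w + k' * (\<Sum>i\<in>UNIV. real_cond_exp M F (B i) w) + real_cond_exp M F N w / p"
        unfolding elim using p by (simp add: add_divide_distrib)
      then show ?case
        unfolding elim(1) by (simp add: A_def[abs_def] B_def[abs_def] algebra_simps)
    qed
  qed (use h v in measurable)
qed

section \<open>From averaged bounds to capacities\<close>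

lemma subalgebra_gen_by:
  "X \<in> M \<rightarrow>\<^sub>M N \<Longrightarrow> subalgebra M (gen_by M X N)"
  by (auto simp: subalgebra_def gen_by_def intro: sets_image_in_sets[THEN subsetD])

text \<open>Finite power is read off the representation as a linear image of white noise, so a
  singular R is covered.\<close>

lemma is_cn_integrable_sq:
  fixes h :: "'w \<Rightarrow> complex ^ 'n"
  assumes h: "h \<in> borel_measurable M" and law: "is_cn (distr M borel h) R"
  shows "integrable M (\<lambda>w. (norm (h w))\<^sup>2)"
proof -
  from law obtain B :: "complex ^ 'n ^ 'n" where B: "distr M borel h = distr (cn_diag (\<chi> i. 1)) borel (\<lambda>w. B *v w)"
    unfolding is_cn_def by blast
  have "(\<lambda>w. B *v w) \<in> borel_measurable (cn_diag (\<chi> i. 1))"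
    unfolding matrix_vector_mult_def
    by (intro borel_measurable_vec_lambda borel_measurable_sum borel_measurable_times borel_measurable_vec_nth)
      (auto simp: measurable_cong_sets[OF sets_cn_diag refl])
  moreover have "integrable (cn_diag (\<chi> i. 1)) (\<lambda>w. (norm (B *v w))\<^sup>2)"
    unfolding norm_vec_sq matrix_vector_mult_def vec_lambda_beta
    by (intro Bochner_Integration.integrable_sum centeredD(3)[OF centered_cn_diag]) simp
  ultimately have "integrable (distr M borel h) (\<lambda>x. (norm x)\<^sup>2)"
    unfolding B by (simp add: integrable_distr_eq)
  then show ?thesis using h by (simp add: integrable_distr_eq)
qed

text \<open>Makes the beam an admissible input kernel: it is the image of one fixed law under a map
  jointly measurable in symbol and beam direction.\<close>

lemma measurable_beam_law [measurable]:
  "beam_law p \<in> borel \<rightarrow>\<^sub>M prob_algebra borel"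
proof -
  have "cn p \<in> space (prob_algebra borel)" by (simp add: space_prob_algebra)
  then show ?thesis
    unfolding beam_law_def
    by (intro measurable_distr_prob_space2[where M = borel] measurable_const)
      (auto simp: split_beta' intro!: borel_measurable_vector_scale borel_measurable_cvec)
qed

lemma ergodic_rate_le_capacity:
  assumes f: "f \<in> input_kernels MK adm"
    and le: "(\<integral>\<^sup>+w. ennreal (log 2 (1 + sinr w)) \<partial>M) \<le> (\<integral>\<^sup>+w. ennreal (info w (f (K w))) \<partial>M)"
  shows "ergodic_rate tau M sinr \<le> ergodic_capacity tau M K MK adm info"
  unfolding ergodic_rate_def ergodic_capacity_def
  by (intro mult_left_mono order_trans[OF le] SUP_upper f) simp

lemma integrable_herm_quadratic:
  fixes Q :: "'w \<Rightarrow> complex ^ 'n ^ 'n" and v :: "'w \<Rightarrow> complex ^ 'n"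
  assumes Q: "\<And>i j. integrable M (\<lambda>w. Q w $ i $ j)"
    and v: "v \<in> borel_measurable M" "\<And>w. norm (v w) = 1"
  shows "integrable M (\<lambda>w. Re (herm (v w) (Q w *v v w)))"
proof -
  have "integrable M (\<lambda>w. cnj (v w $ i) * (Q w $ i $ j * v w $ j))" for i j
  proof (rule Bochner_Integration.integrable_bound[OF Q[of i j]])
    show "(\<lambda>w. cnj (v w $ i) * (Q w $ i $ j * v w $ j)) \<in> borel_measurable M"
      by (intro borel_measurable_times borel_measurable_cnj borel_measurable_vec_nth v borel_measurable_integrable[OF Q])
    have "cmod (v w $ l) \<le> 1" for w l
      using Finite_Cartesian_Product.norm_nth_le[of "v w" l] by (simp add: v)
    then have "cmod (v w $ i) * (cmod (Q w $ i $ j) * cmod (v w $ j)) \<le> 1 * (cmod (Q w $ i $ j) * 1)" for w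
      by (intro mult_mono) auto
    then show "AE w in M. norm (cnj (v w $ i) * (Q w $ i $ j * v w $ j)) \<le> norm (Q w $ i $ j)"
      by (simp add: norm_mult)
  qed
  then have "integrable M (\<lambda>w. herm (v w) (Q w *v v w))"
    unfolding herm_def matrix_vector_mult_def vec_lambda_beta sum_distrib_left
    by (intro Bochner_Integration.integrable_sum)
  then show ?thesis by (rule integrable_Re)
qed

theorem theorem3:
  fixes M :: "'w measure"
    and H :: "'w \<Rightarrow> 'h" and MH :: "'h measure" and chan :: "'h \<Rightarrow> complex ^ 'n"
    and HBS :: "'w \<Rightarrow> 'b" and MB :: "'b measure"
    and HUE :: "'w \<Rightarrow> 'u" and MU :: "'u measure"
    and HBS' :: "'w \<Rightarrow> 'y" and MB' :: "'y measure"
    and HUE' :: "'w \<Rightarrow> 'x" and MU' :: "'x measure"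
    and R S :: "complex ^ 'n ^ 'n"
    and ktBS krBS ktUE krUE sigmaBS sigmaUE pBS pUE :: real
    and Tcoher Tdl Tul :: nat
    and JUE :: "'h \<Rightarrow> complex measure" and IUE :: "'h \<Rightarrow> real"
    and JBS :: "'h \<Rightarrow> (complex ^ 'n) measure" and Q :: "'h \<Rightarrow> complex ^ 'n ^ 'n"
    and pilot :: complex and eta_t :: "'w \<Rightarrow> complex"
    and eta_r nu_noise nu_interf :: "'w \<Rightarrow> complex ^ 'n"
    and vDL vUL :: "complex ^ 'n \<Rightarrow> complex ^ 'n"
    and h hhat :: "'w \<Rightarrow> complex ^ 'n" and G FUE FBS :: "'w measure"
  defines "h \<equiv> \<lambda>w. chan (H w)"
    and "hhat \<equiv> \<lambda>w. lmmse_estimate ktUE krBS sigmaBS pUE R S pilot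
           (ul_signal (h w) pilot (eta_t w) (eta_r w) (nu_noise w + nu_interf w))"
    and "G \<equiv> gen_by M (\<lambda>w. (H w, HBS w, HUE w)) (MH \<Otimes>\<^sub>M (MB \<Otimes>\<^sub>M MU))"
    and "FUE \<equiv> gen_by M HUE' MU'"
    and "FBS \<equiv> gen_by M HBS' MB'"
  assumes prob: "prob_space M"
    and params: "0 \<le> ktBS" "0 \<le> krBS" "0 \<le> ktUE" "0 \<le> krUE"
      "0 < sigmaBS" "0 < sigmaUE" "0 < pBS" "0 < pUE"
    and times: "0 < Tcoher" "Tdl + Tul \<le> Tcoher"
    \<comment> \<open>channel and CSI\<close>
    and H: "H \<in> M \<rightarrow>\<^sub>M MH" and chan: "chan \<in> MH \<rightarrow>\<^sub>M borel"
    and h_law: "is_cn (distr M borel h) R"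
    and HBS: "HBS \<in> M \<rightarrow>\<^sub>M MB" and HUE: "HUE \<in> M \<rightarrow>\<^sub>M MU"
    and HBS': "HBS' \<in> M \<rightarrow>\<^sub>M MB'" and HUE': "HUE' \<in> M \<rightarrow>\<^sub>M MU'"
    and deg_UE: "degraded M G (gen_by M HUE MU) FUE"
    and deg_BS: "degraded M G (gen_by M HBS MB) FBS"
    \<comment> \<open>uplink pilot phase\<close>
    and pilot: "(cmod pilot)\<^sup>2 = pUE"
    and pilot_noise: "has_cond_law M
        (\<lambda>w. (eta_t w, eta_r w, nu_noise w)) (borel \<Otimes>\<^sub>M (borel \<Otimes>\<^sub>M borel))
        (\<lambda>w. (H w, nu_interf w)) (MH \<Otimes>\<^sub>M borel)
        (\<lambda>(x, u). ul_noise_law ktUE krBS sigmaBS pUE (chan x))"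
    and pilot_interf: "integrable M (\<lambda>w. (norm (nu_interf w))\<^sup>2)"
      "(\<integral>w. nu_interf w \<partial>M) = 0"
      "\<And>i j. (\<integral>w. nu_interf w $ i * cnj (nu_interf w $ j) \<partial>M) = S $ i $ j"
      "\<And>i j. (\<integral>w. h w $ i * cnj (nu_interf w $ j) \<partial>M) = 0"
    and hhat_known: "\<exists>g \<in> MB \<rightarrow>\<^sub>M borel. \<forall>w\<in>space M. hhat w = g (HBS w)"
    \<comment> \<open>interference in the data phases, given the channels\<close>
    and JUE: "JUE \<in> MH \<rightarrow>\<^sub>M prob_algebra borel"
      "\<And>x. x \<in> space MH \<Longrightarrow> integrable (JUE x) (\<lambda>u. (cmod u)\<^sup>2)"
      "\<And>x. x \<in> space MH \<Longrightarrow> (\<integral>u. u \<partial>JUE x) = 0"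
      "\<And>x. x \<in> space MH \<Longrightarrow> (\<integral>u. (cmod u)\<^sup>2 \<partial>JUE x) = IUE x"
    and IUE: "integrable M (\<lambda>w. IUE (H w))"
    and JBS: "JBS \<in> MH \<rightarrow>\<^sub>M prob_algebra borel"
      "\<And>x. x \<in> space MH \<Longrightarrow> integrable (JBS x) (\<lambda>u. (norm u)\<^sup>2)"
      "\<And>x. x \<in> space MH \<Longrightarrow> (\<integral>u. u \<partial>JBS x) = 0"
      "\<And>x. x \<in> space MH \<Longrightarrow> corr_mat (JBS x) = Q x"
    and Q: "\<And>i j. integrable M (\<lambda>w. Q (H w) $ i $ j)"
    \<comment> \<open>beamforming and receive combining\<close>
    and vDL: "vDL \<in> borel_measurable borel" "\<And>x. norm (vDL x) = 1"
    and vUL: "vUL \<in> borel_measurable borel" "\<And>x. norm (vUL x) = 1"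
  shows "ergodic_capacity (real Tdl / real Tcoher) M HBS MB (dl_input pBS)
           (\<lambda>w. dl_mutual_info ktBS krUE sigmaUE (h w) (JUE (H w)))
         \<ge> ergodic_rate (real Tdl / real Tcoher) M
             (dl_sinr_lower ktBS krUE sigmaUE pBS M FUE h (\<lambda>w. IUE (H w)) (\<lambda>w. vDL (hhat w)))
       \<and> ergodic_capacity (real Tul / real Tcoher) M HUE MU (ul_input pUE)
           (\<lambda>w. ul_mutual_info ktUE krBS sigmaBS pUE (h w) (JBS (H w)))
         \<ge> ergodic_rate (real Tul / real Tcoher) M
             (ul_sinr_lower ktUE krBS sigmaBS pUE M FBS h (\<lambda>w. Q (H w)) (\<lambda>w. vUL (hhat w)))"
proof -
  interpret prob_space M by (rule prob)
  note [measurable] = H chan vDL(1) vUL(1)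
  \<comment> \<open>Through \<open>g\<close> the beamformer becomes a function of the knowledge at
    the transmitter, as an input kernel must be.\<close>
  from hhat_known obtain g where g[measurable]: "g \<in> MB \<rightarrow>\<^sub>M borel" and hhat_g: "\<And>w. w \<in> space M \<Longrightarrow> hhat w = g (HBS w)"
    by blast
  have h_meas: "h \<in> borel_measurable M" unfolding h_def by measurable
  have ih: "integrable M (\<lambda>w. (norm (h w))\<^sup>2)" by (rule is_cn_integrable_sq[OF h_meas h_law])
  have "(\<lambda>w. g (HBS w)) \<in> borel_measurable M" using HBS by measurable
  then have hhat_meas[measurable]: "hhat \<in> borel_measurable M"
    by (subst measurable_cong[OF hhat_g])
  have subU: "subalgebra M FUE" unfolding FUE_def by (rule subalgebra_gen_by[OF HUE'])
  have subB: "subalgebra M FBS" unfolding FBS_def by (rule subalgebra_gen_by[OF HBS'])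
  interpret U: finite_measure_subalgebra M FUE by unfold_locales (fact subU)
  have spH: "H w \<in> space MH" if "w \<in> space M" for w using H that by (rule measurable_space)
  have JUE_prob: "prob_space (JUE x)" "sets (JUE x) = sets borel" if "x \<in> space MH" for x
    using measurable_space[OF JUE(1) that] by (auto simp: space_prob_algebra)
  have JBS_prob: "prob_space (JBS x)" "sets (JBS x) = sets borel" if "x \<in> space MH" for x
    using measurable_space[OF JBS(1) that] by (auto simp: space_prob_algebra)
  have "ergodic_rate (real Tdl / real Tcoher) M
             (dl_sinr_lower ktBS krUE sigmaUE pBS M FUE h (\<lambda>w. IUE (H w)) (\<lambda>w. vDL (hhat w)))
     \<le> ergodic_capacity (real Tdl / real Tcoher) M HBS MB (dl_input pBS)
           (\<lambda>w. dl_mutual_info ktBS krUE sigmaUE (h w) (JUE (H w)))"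
  proof (rule ergodic_rate_le_capacity[where f = "\<lambda>k. beam_law pBS (vDL (g k))"])
    show "(\<lambda>k. beam_law pBS (vDL (g k))) \<in> input_kernels MB (dl_input pBS)"
      unfolding input_kernels_def using params(7) by (auto intro!: beam_law(4) vDL(2))
    show "(\<integral>\<^sup>+w. ennreal (log 2 (1 + dl_sinr_lower ktBS krUE sigmaUE pBS M FUE h (\<lambda>w. IUE (H w)) (\<lambda>w. vDL (hhat w)) w)) \<partial>M)
      \<le> (\<integral>\<^sup>+w. ennreal (dl_mutual_info ktBS krUE sigmaUE (h w) (JUE (H w)) (beam_law pBS (vDL (g (HBS w))))) \<partial>M)"
    proof (rule csi_rate_le[where N = "\<lambda>w. IUE (H w) + sigmaUE\<^sup>2" and \<sigma> = "sigmaUE\<^sup>2" and k = krUE and k' = ktBS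
          and v = "\<lambda>w. vDL (hhat w)" and p = pBS, OF prob subU h_meas ih])
      show "integrable M (\<lambda>w. IUE (H w) + sigmaUE\<^sup>2)" using IUE by simp
      \<comment> \<open>The interference power is nonnegative as a second moment of
        \<open>JUE\<close>.\<close>
      show "sigmaUE\<^sup>2 \<le> IUE (H w) + sigmaUE\<^sup>2" if "w \<in> space M" for w
        using JUE(4)[OF spH[OF that]] by (auto intro: Bochner_Integration.integral_nonneg simp flip: JUE(4)[OF spH[OF that]])
      show "(ln (pBS / e) + 1 - (pBS - 2 * pBS * Re (a * cnj (herm (h w) (vDL (hhat w))))
          + (cmod a)\<^sup>2 * (pBS * second_moment_gain krUE ktBS (h w) (vDL (hhat w)) + (IUE (H w) + sigmaUE\<^sup>2))) / e) / ln 2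
        \<le> dl_mutual_info ktBS krUE sigmaUE (h w) (JUE (H w)) (beam_law pBS (vDL (g (HBS w))))"
        if w: "w \<in> space M" and e: "0 < e" for w a e
        unfolding hhat_g[OF w, symmetric]
        by (rule dl_mutual_info_ge) (use params e vDL(2) JUE JUE_prob spH[OF w] in auto)
      \<comment> \<open>The downlink SINR lists the noise power outside the conditional expectation,
        the shared lemma inside; a constant is its own conditional expectation.\<close>
      have "AE w in M. real_cond_exp M FUE (\<lambda>w. IUE (H w) + sigmaUE\<^sup>2) w
          = real_cond_exp M FUE (\<lambda>w. IUE (H w)) w + real_cond_exp M FUE (\<lambda>w. sigmaUE\<^sup>2) w"
        using IUE by (intro U.real_cond_exp_add) auto
      moreover have "AE w in M. real_cond_exp M FUE (\<lambda>w. sigmaUE\<^sup>2) w = sigmaUE\<^sup>2"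
        by (intro U.real_cond_exp_F_meas) auto
      ultimately show "AE w in M. dl_sinr_lower ktBS krUE sigmaUE pBS M FUE h (\<lambda>w. IUE (H w)) (\<lambda>w. vDL (hhat w)) w =
         (cmod (complex_cond_exp M FUE (\<lambda>w. herm (h w) (vDL (hhat w))) w))\<^sup>2 /
         ((1 + krUE) * real_cond_exp M FUE (\<lambda>w. (cmod (herm (h w) (vDL (hhat w))))\<^sup>2) w
           - (cmod (complex_cond_exp M FUE (\<lambda>w. herm (h w) (vDL (hhat w))) w))\<^sup>2
           + ktBS * (\<Sum>i\<in>UNIV. real_cond_exp M FUE (\<lambda>w. (cmod (h w $ i))\<^sup>2 * (cmod (vDL (hhat w) $ i))\<^sup>2) w)
           + real_cond_exp M FUE (\<lambda>w. IUE (H w) + sigmaUE\<^sup>2) w / pBS)"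
        by eventually_elim (simp add: dl_sinr_lower_def add_divide_distrib add.assoc)
    qed (use params vDL(2) in auto)
  qed
  moreover have "ergodic_rate (real Tul / real Tcoher) M
             (ul_sinr_lower ktUE krBS sigmaBS pUE M FBS h (\<lambda>w. Q (H w)) (\<lambda>w. vUL (hhat w)))
     \<le> ergodic_capacity (real Tul / real Tcoher) M HUE MU (ul_input pUE)
           (\<lambda>w. ul_mutual_info ktUE krBS sigmaBS pUE (h w) (JBS (H w)))"
  proof (rule ergodic_rate_le_capacity[where f = "\<lambda>k. cn pUE"])
    \<comment> \<open>The uplink input ignores the state at the UE: a constant kernel.\<close>
    have "cn pUE \<in> space (prob_algebra borel)" by (simp add: space_prob_algebra)
    then show "(\<lambda>k. cn pUE) \<in> input_kernels MU (ul_input pUE)"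
      using centeredD(3,5)[OF centered_cn[of pUE]] params(8)
      unfolding input_kernels_def ul_input_def by auto
    let ?N = "\<lambda>w. Re (herm (vUL (hhat w)) ((Q (H w) + mat (complex_of_real (sigmaBS\<^sup>2))) *v vUL (hhat w)))"
    have N: "?N w = Re (herm (vUL (hhat w)) (Q (H w) *v vUL (hhat w))) + sigmaBS\<^sup>2" for w
      by (rule Re_herm_add_mat[OF vUL(2)])
    show "(\<integral>\<^sup>+w. ennreal (log 2 (1 + ul_sinr_lower ktUE krBS sigmaBS pUE M FBS h (\<lambda>w. Q (H w)) (\<lambda>w. vUL (hhat w)) w)) \<partial>M)
      \<le> (\<integral>\<^sup>+w. ennreal (ul_mutual_info ktUE krBS sigmaBS pUE (h w) (JBS (H w)) (cn pUE)) \<partial>M)"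
    proof (rule csi_rate_le[where N = ?N and \<sigma> = "sigmaBS\<^sup>2" and k = ktUE and k' = krBS
          and v = "\<lambda>w. vUL (hhat w)" and p = pUE, OF prob subB h_meas ih])
      show "integrable M ?N"
        unfolding N using integrable_herm_quadratic[OF Q, of "\<lambda>w. vUL (hhat w)"] vUL(2) by simp
      show "sigmaBS\<^sup>2 \<le> ?N w" if w: "w \<in> space M" for w
      proof -
        note x = spH[OF w]
        \<comment> \<open>The quadratic form is the second moment of v^H u with u drawn from the
          interference law, hence nonnegative.\<close>
        have "Re (herm (vUL (hhat w)) (corr_mat (JBS (H w)) *v vUL (hhat w))) \<ge> 0"
          unfolding centeredD(5)[OF centered_herm[OF JBS_prob[OF x] JBS(2,3)[OF x]], symmetric]
          by (rule Bochner_Integration.integral_nonneg) simp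
        then show ?thesis unfolding N JBS(4)[OF x] by simp
      qed
      show "(ln (pUE / e) + 1 - (pUE - 2 * pUE * Re (a * cnj (herm (h w) (vUL (hhat w))))
          + (cmod a)\<^sup>2 * (pUE * second_moment_gain ktUE krBS (h w) (vUL (hhat w)) + ?N w)) / e) / ln 2
        \<le> ul_mutual_info ktUE krBS sigmaBS pUE (h w) (JBS (H w)) (cn pUE)"
        if w: "w \<in> space M" and e: "0 < e" for w a e
        by (rule ul_mutual_info_ge) (use params e vUL(2) JBS JBS_prob spH[OF w] in auto)
    qed (use params vUL(2) in \<open>auto simp: ul_sinr_lower_def\<close>)
  qed
  ultimately show ?thesis by blast
qed

end
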